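(* Quantum categories in $\mathcal V$ and functors between them, with composition of $(f,\varphi):(C,A)\to(C',A')$ and $(f',\varphi'):(C',A')\to(C'',A'')$ given by $(f'f,\varphi'\varphi)$ and with identities $(1,1)$, form a category $\mathrm{qCat}\,\mathcal V$.
   Context: Standing assumptions. $\mathcal V=(\mathcal V,\otimes,I,c)$ is a braided monoidal category (associativity and unit isomorphisms suppressed) with finite colimits and with equalizers of coreflexive pairs, and each functor $X\otimes-$ preserves equalizers of coreflexive pairs. The bicategory $\mathcal C=\mathrm{Comod}\,\mathcal V$. Objects are comonoids $C=(C,\delta,\epsilon)$ in $\mathcal V$; $\delta_3=(\delta\otimes1)\delta$. A 1-cell from $C$ to $D$ is a comodule from $C$ to $D$: an object $M$ with a coaction $M\to C\otimes M\otimes D$ making it a coalgebra for the comonad $C\otimes-\otimes D$. It gives a left $C$-coaction and a right $D$-coaction by applying counits. 2-cells are coaction-respecting maps. For $M$ from $E$ to $C$ and $N$ from $C$ to $F$, the composite is $N\circ M=M\otimes_CN$, the equalizer of $\delta_r\otimes1,\,1\otimes\delta_l:M\otimes N\rightrightarrows M\otimes C\otimes N$; the identity on $C$ is $C$ with coaction $\delta_3$. $\mathcal C$ is a monoidal bicategory: $C\otimes C'$ has comultiplication $(1\otimes c\otimes1)(\delta\otimes\delta')$ and counit $\epsilon\otimes\epsilon'$; the tensor product of comodules $M:C\to D$, $N:C'\to D'$ is $M\otimes N$ with coaction $M\otimes N\to C\otimes M\otimes D\otimes C'\otimes N\otimes D'\to C\otimes C'\otimes M\otimes N\otimes D\otimes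 D'$, the second map coming from the braiding $c$. The monoidale $C^o\otimes C$. $C^o=(C,c\delta,\epsilon)$. Let $e:C\otimes C^o\to I$ be the comodule $C$ with coaction $(1\otimes c)\delta_3$, and $j:I\to C^o\otimes C$ the comodule $C$ with coaction $(c\otimes1)\delta_3$. With $p=C^o\otimes e\otimes C:C^o\otimes C\otimes C^o\otimes C\to C^o\otimes C$ as multiplication and $j$ as unit, $C^o\otimes C$ is a monoidale (pseudomonoid) in $\mathcal C$. Quantum graphs. A quantum graph $(C,A)$ consists of a comonoid $C$ and a comonad $A$ on $C^o\otimes C$ in $\mathcal C$. Equivalently, $A$ is a comonoid together with comonoid maps $s:A\to C^o$, $t:A\to C$ satisfying $c(s\otimes t)\delta=(t\otimes s)\delta$; the comonad counit is $(s\otimes t)\delta:A\to C\otimes C$. $A$ is regarded as a comodule from $C$ to $C$ with left coaction $c^{-1}(1\otimes s)\delta:A\to C\otimes A$ and right coaction $(1\otimes t)\delta:A\to A\otimes C$. $H=A\otimes_CA$ is formed with these coactions; $H$ is the underlying object of $p\circ(A\otimes A)$. Quantum categories. A quantum category $(C,A)$ is a quantum graph with 2-cells $\mu_2:p\circ(A\otimes A)\Rightarrow A\circ p$ and $\mu_0:j\Rightarrow A\circ j$ in $\mathcal C$ making $A$ a monoidal comonad, i.e. $(A,\mu_2,\mu_0)$ is a (lax) monoidal morphism of the monoidale $C^o\otimes C$, and $(p,\mu_2):(C^o\otimes C\otimes C^o\otimes C,A\otimes A)\to(C^o\otimes C,A)$ and $(j,\mu_0):(I,1)\to(C^o\otimes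 C,A)$ are comonad maps (a comonad map $(k,\kappa):(B,g)\to(B',g')$ is a 1-cell $k$ with a 2-cell $\kappa:kg\Rightarrow g'k$ satisfying $(g'\kappa)(\kappa g)(k\delta)=(\delta k)\kappa$ and $(\epsilon k)\kappa=k\epsilon$). Identifying $A\circ p$ with $C\otimes A$ and regarding $\mu_0$ as a map $C\to C\otimes_{C^o\otimes C}A\subseteq C\otimes A$, the composition map is $\nu_2=(\epsilon\otimes1)\mu_2:A\otimes_CA\to A$ and the unit map is $\nu_0=(\epsilon\otimes1)\mu_0:C\to A$. Functors. A functor $(f,\varphi):(C,A)\to(C',A')$ of quantum categories (in the explicit form the paper derives from its definition as an opmorphism of monoidal comonads) consists of comonoid maps $f:C\to C'$ and $\varphi:A\to A'$ with $s\varphi=fs$ and $t\varphi=ft$, $\varphi\nu_0=\nu_0f:C\to A'$, and $\varphi\,\nu_2=\nu_2\,(\varphi\otimes_{C'}\varphi)\,\iota:A\otimes_CA\to A'$. Here $A\otimes_{C'}A$ is formed by regarding $A$ as a comodule from $C'$ to $C'$ with left coaction $c^{-1}(1\otimes s\varphi)\delta$ and right coaction $(1\otimes t\varphi)\delta$, $\iota:A\otimes_CA\to A\otimes_{C'}A$ is the canonical map compatible with the inclusions into $A\otimes A$, and $\varphi\otimes_{C'}\varphi:A\otimes_{C'}A\to A'\otimes_{C'}A'$ is induced by $\varphi\otimes\varphi$. *)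

theory Defs
  imports Main
begin

section \<open>Categories, equalizers, finite colimits\<close>

record ('o, 'a) cat =
  Ob :: "'o set"
  Ar :: "'a set"
  Dom :: "'a \<Rightarrow> 'o"
  Cod :: "'a \<Rightarrow> 'o"
  Id :: "'o \<Rightarrow> 'a" ("\<one>\<index>")
  Comp :: "'a \<Rightarrow> 'a \<Rightarrow> 'a" (infixr "\<cdot>\<index>" 65)

definition Hom :: "('o, 'a, 'm) cat_scheme \<Rightarrow> 'o \<Rightarrow> 'o \<Rightarrow> 'a set" where
  "Hom V x y = {f \<in> Ar V. Dom V f = x \<and> Cod V f = y}"

locale category =
  fixes V :: "('o, 'a, 'm) cat_scheme" (structure)
  assumes Dom_Ob: "f \<in> Ar V \<Longrightarrow> Dom V f \<in> Ob V"
    and Cod_Ob: "f \<in> Ar V \<Longrightarrow> Cod V f \<in> Ob V"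
    and Id_Hom: "x \<in> Ob V \<Longrightarrow> \<one> x \<in> Hom V x x"
    and Comp_Hom: "f \<in> Hom V x y \<Longrightarrow> g \<in> Hom V y z \<Longrightarrow> g \<cdot> f \<in> Hom V x z"
    and Comp_Id_right: "f \<in> Hom V x y \<Longrightarrow> f \<cdot> \<one> x = f"
    and Comp_Id_left: "f \<in> Hom V x y \<Longrightarrow> \<one> y \<cdot> f = f"
    and Comp_assoc: "f \<in> Hom V w x \<Longrightarrow> g \<in> Hom V x y \<Longrightarrow> h \<in> Hom V y z \<Longrightarrow>
      (h \<cdot> g) \<cdot> f = h \<cdot> (g \<cdot> f)"

definition inverse_arrows :: "('o, 'a, 'm) cat_scheme \<Rightarrow> 'a \<Rightarrow> 'a \<Rightarrow> bool" where
  "inverse_arrows V f g \<longleftrightarrow> f \<in> Ar V \<and> g \<in> Hom V (Cod V f) (Dom V f) \<and>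
     g \<cdot>\<^bsub>V\<^esub> f = \<one>\<^bsub>V\<^esub> (Dom V f) \<and> f \<cdot>\<^bsub>V\<^esub> g = \<one>\<^bsub>V\<^esub> (Cod V f)"

definition is_iso :: "('o, 'a, 'm) cat_scheme \<Rightarrow> 'a \<Rightarrow> bool" where
  "is_iso V f \<longleftrightarrow> (\<exists>g. inverse_arrows V f g)"

definition Inv :: "('o, 'a, 'm) cat_scheme \<Rightarrow> 'a \<Rightarrow> 'a" where
  "Inv V f = (THE g. inverse_arrows V f g)"

definition parallel :: "('o, 'a, 'm) cat_scheme \<Rightarrow> 'a \<Rightarrow> 'a \<Rightarrow> bool" where
  "parallel V f g \<longleftrightarrow> f \<in> Ar V \<and> g \<in> Ar V \<and> Dom V f = Dom V g \<and> Cod V f = Cod V g"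

definition coreflexive_pair :: "('o, 'a, 'm) cat_scheme \<Rightarrow> 'a \<Rightarrow> 'a \<Rightarrow> bool" where
  "coreflexive_pair V f g \<longleftrightarrow> parallel V f g \<and>
     (\<exists>r \<in> Hom V (Cod V f) (Dom V f). r \<cdot>\<^bsub>V\<^esub> f = \<one>\<^bsub>V\<^esub> (Dom V f) \<and> r \<cdot>\<^bsub>V\<^esub> g = \<one>\<^bsub>V\<^esub> (Dom V f))"

definition is_equalizer :: "('o, 'a, 'm) cat_scheme \<Rightarrow> 'a \<Rightarrow> 'a \<Rightarrow> 'a \<Rightarrow> bool" where
  "is_equalizer V f g e \<longleftrightarrow> parallel V f g \<and> e \<in> Ar V \<and> Cod V e = Dom V f \<and>
     f \<cdot>\<^bsub>V\<^esub> e = g \<cdot>\<^bsub>V\<^esub> e \<and>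
     (\<forall>h \<in> Ar V. Cod V h = Dom V f \<and> f \<cdot>\<^bsub>V\<^esub> h = g \<cdot>\<^bsub>V\<^esub> h \<longrightarrow>
        (\<exists>!u. u \<in> Hom V (Dom V h) (Dom V e) \<and> e \<cdot>\<^bsub>V\<^esub> u = h))"

definition is_diagram ::
  "('i, 'u, 'n) cat_scheme \<Rightarrow> ('o, 'a, 'm) cat_scheme \<Rightarrow> ('i \<Rightarrow> 'o) \<Rightarrow> ('u \<Rightarrow> 'a) \<Rightarrow> bool" where
  "is_diagram J V F0 F1 \<longleftrightarrow>
     (\<forall>i \<in> Ob J. F0 i \<in> Ob V \<and> F1 (\<one>\<^bsub>J\<^esub> i) = \<one>\<^bsub>V\<^esub> (F0 i)) \<and>
     (\<forall>u \<in> Ar J. F1 u \<in> Hom V (F0 (Dom J u)) (F0 (Cod J u))) \<and>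
     (\<forall>u \<in> Ar J. \<forall>v \<in> Ar J. Cod J u = Dom J v \<longrightarrow> F1 (v \<cdot>\<^bsub>J\<^esub> u) = F1 v \<cdot>\<^bsub>V\<^esub> F1 u)"

definition is_cocone ::
  "('i, 'u, 'n) cat_scheme \<Rightarrow> ('o, 'a, 'm) cat_scheme \<Rightarrow> ('i \<Rightarrow> 'o) \<Rightarrow> ('u \<Rightarrow> 'a) \<Rightarrow>
   'o \<Rightarrow> ('i \<Rightarrow> 'a) \<Rightarrow> bool" where
  "is_cocone J V F0 F1 x k \<longleftrightarrow> x \<in> Ob V \<and> (\<forall>i \<in> Ob J. k i \<in> Hom V (F0 i) x) \<and>
     (\<forall>u \<in> Ar J. k (Cod J u) \<cdot>\<^bsub>V\<^esub> F1 u = k (Dom J u))"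

definition is_colimit ::
  "('i, 'u, 'n) cat_scheme \<Rightarrow> ('o, 'a, 'm) cat_scheme \<Rightarrow> ('i \<Rightarrow> 'o) \<Rightarrow> ('u \<Rightarrow> 'a) \<Rightarrow>
   'o \<Rightarrow> ('i \<Rightarrow> 'a) \<Rightarrow> bool" where
  "is_colimit J V F0 F1 x k \<longleftrightarrow> is_cocone J V F0 F1 x k \<and>
     (\<forall>y l. is_cocone J V F0 F1 y l \<longrightarrow>
        (\<exists>!h. h \<in> Hom V x y \<and> (\<forall>i \<in> Ob J. h \<cdot>\<^bsub>V\<^esub> k i = l i)))"

text \<open>Every finite category is isomorphic to one whose objects and arrows are natural numbers.\<close>

definition has_finite_colimits :: "('o, 'a, 'm) cat_scheme \<Rightarrow> bool" where
  "has_finite_colimits V \<longleftrightarrow>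
     (\<forall>(J :: (nat, nat) cat) F0 F1. category J \<and> finite (Ob J) \<and> finite (Ar J) \<and> is_diagram J V F0 F1 \<longrightarrow>
        (\<exists>x k. is_colimit J V F0 F1 x k))"


section \<open>Braided monoidal categories\<close>

record ('o, 'a) tensor_cat = "('o, 'a) cat" +
  Unit :: 'o
  TensO :: "'o \<Rightarrow> 'o \<Rightarrow> 'o" (infixr "\<otimes>\<^sub>o\<index>" 70)
  TensA :: "'a \<Rightarrow> 'a \<Rightarrow> 'a" (infixr "\<otimes>\<index>" 70)
  Braid :: "'o \<Rightarrow> 'o \<Rightarrow> 'a"

record ('o, 'a) bmc = "('o, 'a) tensor_cat" +
  Assoc :: "'o \<Rightarrow> 'o \<Rightarrow> 'o \<Rightarrow> 'a"
  LU :: "'o \<Rightarrow> 'a"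
  RU :: "'o \<Rightarrow> 'a"

locale braided_monoidal_category = category V
  for V :: "('o, 'a, 'm) bmc_scheme" (structure) +
  assumes Unit_Ob: "Unit V \<in> Ob V"
    and TensO_Ob: "x \<in> Ob V \<Longrightarrow> y \<in> Ob V \<Longrightarrow> x \<otimes>\<^sub>o y \<in> Ob V"
    and TensA_Hom: "f \<in> Hom V x x' \<Longrightarrow> g \<in> Hom V y y' \<Longrightarrow> f \<otimes> g \<in> Hom V (x \<otimes>\<^sub>o y) (x' \<otimes>\<^sub>o y')"
    and TensA_Id: "x \<in> Ob V \<Longrightarrow> y \<in> Ob V \<Longrightarrow> \<one> x \<otimes> \<one> y = \<one> (x \<otimes>\<^sub>o y)"
    and TensA_Comp: "f \<in> Hom V x x' \<Longrightarrow> f' \<in> Hom V x' x'' \<Longrightarrow> g \<in> Hom V y y' \<Longrightarrow> g' \<in> Hom V y' y'' \<Longrightarrow>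
      (f' \<cdot> f) \<otimes> (g' \<cdot> g) = (f' \<otimes> g') \<cdot> (f \<otimes> g)"
    and Assoc_Hom: "x \<in> Ob V \<Longrightarrow> y \<in> Ob V \<Longrightarrow> z \<in> Ob V \<Longrightarrow>
      Assoc V x y z \<in> Hom V ((x \<otimes>\<^sub>o y) \<otimes>\<^sub>o z) (x \<otimes>\<^sub>o (y \<otimes>\<^sub>o z)) \<and> is_iso V (Assoc V x y z)"
    and LU_Hom: "x \<in> Ob V \<Longrightarrow> LU V x \<in> Hom V (Unit V \<otimes>\<^sub>o x) x \<and> is_iso V (LU V x)"
    and RU_Hom: "x \<in> Ob V \<Longrightarrow> RU V x \<in> Hom V (x \<otimes>\<^sub>o Unit V) x \<and> is_iso V (RU V x)"
    and Braid_Hom: "x \<in> Ob V \<Longrightarrow> y \<in> Ob V \<Longrightarrow>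
      Braid V x y \<in> Hom V (x \<otimes>\<^sub>o y) (y \<otimes>\<^sub>o x) \<and> is_iso V (Braid V x y)"
    and Assoc_natural: "f \<in> Hom V x x' \<Longrightarrow> g \<in> Hom V y y' \<Longrightarrow> h \<in> Hom V z z' \<Longrightarrow>
      Assoc V x' y' z' \<cdot> ((f \<otimes> g) \<otimes> h) = (f \<otimes> (g \<otimes> h)) \<cdot> Assoc V x y z"
    and LU_natural: "f \<in> Hom V x x' \<Longrightarrow> LU V x' \<cdot> (\<one> (Unit V) \<otimes> f) = f \<cdot> LU V x"
    and RU_natural: "f \<in> Hom V x x' \<Longrightarrow> RU V x' \<cdot> (f \<otimes> \<one> (Unit V)) = f \<cdot> RU V x"
    and Braid_natural: "f \<in> Hom V x x' \<Longrightarrow> g \<in> Hom V y y' \<Longrightarrow>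
      Braid V x' y' \<cdot> (f \<otimes> g) = (g \<otimes> f) \<cdot> Braid V x y"
    and pentagon: "w \<in> Ob V \<Longrightarrow> x \<in> Ob V \<Longrightarrow> y \<in> Ob V \<Longrightarrow> z \<in> Ob V \<Longrightarrow>
      Assoc V w x (y \<otimes>\<^sub>o z) \<cdot> Assoc V (w \<otimes>\<^sub>o x) y z =
      (\<one> w \<otimes> Assoc V x y z) \<cdot> Assoc V w (x \<otimes>\<^sub>o y) z \<cdot> (Assoc V w x y \<otimes> \<one> z)"
    and triangle: "x \<in> Ob V \<Longrightarrow> y \<in> Ob V \<Longrightarrow>
      (\<one> x \<otimes> LU V y) \<cdot> Assoc V x (Unit V) y = RU V x \<otimes> \<one> y"
    and hexagon1: "x \<in> Ob V \<Longrightarrow> y \<in> Ob V \<Longrightarrow> z \<in> Ob V \<Longrightarrow>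
      Assoc V y z x \<cdot> Braid V x (y \<otimes>\<^sub>o z) \<cdot> Assoc V x y z =
      (\<one> y \<otimes> Braid V x z) \<cdot> Assoc V y x z \<cdot> (Braid V x y \<otimes> \<one> z)"
    and hexagon2: "x \<in> Ob V \<Longrightarrow> y \<in> Ob V \<Longrightarrow> z \<in> Ob V \<Longrightarrow>
      Inv V (Assoc V z x y) \<cdot> Braid V (x \<otimes>\<^sub>o y) z \<cdot> Inv V (Assoc V x y z) =
      (Braid V x z \<otimes> \<one> y) \<cdot> Inv V (Assoc V x z y) \<cdot> (\<one> x \<otimes> Braid V y z)"

locale quantum_base = braided_monoidal_category V
  for V :: "('o, 'a, 'm) bmc_scheme" (structure) +
  assumes finite_colimits: "has_finite_colimits V"
    and coreflexive_equalizers: "coreflexive_pair V f g \<Longrightarrow> \<exists>e. is_equalizer V f g e"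
    and tensor_preserves: "x \<in> Ob V \<Longrightarrow> coreflexive_pair V f g \<Longrightarrow> is_equalizer V f g e \<Longrightarrow>
      is_equalizer V (\<one> x \<otimes> f) (\<one> x \<otimes> g) (\<one> x \<otimes> e)"


section \<open>Suppressing associativity and unit isomorphisms\<close>

text \<open>
  Formulas in which associativity and unit isomorphisms are suppressed are read in the
  strictification of \<open>V\<close>. Its objects are lists of objects of \<open>V\<close>, and an arrow
  \<open>(xs, f, ys)\<close> is an arrow \<open>f\<close> of \<open>V\<close> from the right-bracketed tensor product of \<open>xs\<close> to that of
  \<open>ys\<close>. An object \<open>x\<close> of \<open>V\<close> is the list \<open>[x]\<close>; for instance, an arrow \<open>[x] \<rightarrow> [x, x]\<close> is just an
  arrow \<open>x \<rightarrow> x \<otimes> x\<close> of \<open>V\<close>.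
\<close>

fun tens_list :: "('o, 'a, 'm) bmc_scheme \<Rightarrow> 'o list \<Rightarrow> 'o" where
  "tens_list V [] = Unit V"
| "tens_list V [x] = x"
| "tens_list V (x # y # ys) = x \<otimes>\<^sub>o\<^bsub>V\<^esub> tens_list V (y # ys)"

text \<open>The coherence isomorphism from \<open>tens_list V xs \<otimes> tens_list V ys\<close> to \<open>tens_list V (xs @ ys)\<close>.\<close>

fun merge :: "('o, 'a, 'm) bmc_scheme \<Rightarrow> 'o list \<Rightarrow> 'o list \<Rightarrow> 'a" where
  "merge V [] ys = LU V (tens_list V ys)"
| "merge V [x] [] = RU V x"
| "merge V [x] (y # ys) = \<one>\<^bsub>V\<^esub> (tens_list V (x # y # ys))"
| "merge V (x # x' # xs) ys =
     (\<one>\<^bsub>V\<^esub> x \<otimes>\<^bsub>V\<^esub> merge V (x' # xs) ys) \<cdot>\<^bsub>V\<^esub> Assoc V x (tens_list V (x' # xs)) (tens_list V ys)"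

definition strictify ::
  "('o, 'a, 'm) bmc_scheme \<Rightarrow> ('o list, 'o list \<times> 'a \<times> 'o list) tensor_cat" where
  "strictify V =
    \<lparr> Ob = {xs. set xs \<subseteq> Ob V},
      Ar = {(xs, f, ys). set xs \<subseteq> Ob V \<and> set ys \<subseteq> Ob V \<and> f \<in> Hom V (tens_list V xs) (tens_list V ys)},
      Dom = (\<lambda>(xs, f, ys). xs),
      Cod = (\<lambda>(xs, f, ys). ys),
      Id = (\<lambda>xs. (xs, \<one>\<^bsub>V\<^esub> (tens_list V xs), xs)),
      Comp = (\<lambda>(ys', g, zs) (xs, f, ys). (xs, g \<cdot>\<^bsub>V\<^esub> f, zs)),
      Unit = [],
      TensO = (@),
      TensA = (\<lambda>(xs, f, ys) (xs', f', ys').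
        (xs @ xs', merge V ys ys' \<cdot>\<^bsub>V\<^esub> (f \<otimes>\<^bsub>V\<^esub> f') \<cdot>\<^bsub>V\<^esub> Inv V (merge V xs xs'), ys @ ys')),
      Braid = (\<lambda>xs ys.
        (xs @ ys, merge V ys xs \<cdot>\<^bsub>V\<^esub> Braid V (tens_list V xs) (tens_list V ys) \<cdot>\<^bsub>V\<^esub> Inv V (merge V xs ys), ys @ xs)) \<rparr>"


section \<open>The monoidal bicategory of comodules\<close>

record ('o, 'a) comonoid =
  obj :: 'o
  comult :: 'a
  counit :: 'a

text \<open>1-cells: an object \<open>bimod\<close> with a coaction \<open>bimod \<rightarrow> src \<otimes> bimod \<otimes> tgt\<close>.\<close>

record ('o, 'a) comodule =
  src :: "('o, 'a) comonoid"
  tgt :: "('o, 'a) comonoid"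
  bimod :: 'o
  coact :: 'a

record ('o, 'a) monoidale =
  mob :: "('o, 'a) comonoid"
  mmul :: "('o, 'a) comodule"
  munit :: "('o, 'a) comodule"
  massoc :: 'a
  mlunit :: 'a
  mrunit :: 'a

text \<open>
  A quantum category: \<open>base\<close> is \<open>C\<close>; \<open>edge\<close> with \<open>cmult\<close> and \<open>ccounit\<close> is the comonad \<open>A\<close>
  on \<open>C\<^sup>o \<otimes> C\<close>; \<open>mu2\<close> and \<open>mu0\<close> are the monoidal structure of \<open>A\<close>.
\<close>

record ('o, 'a) qcat =
  base :: "('o, 'a) comonoid"
  edge :: "('o, 'a) comodule"
  cmult :: 'a
  ccounit :: 'a
  mu2 :: 'a
  mu0 :: 'a

locale tensor_data =
  fixes S :: "('o, 'a, 'm) tensor_cat_scheme" (structure)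
begin

definition eqz :: "'a \<Rightarrow> 'a \<Rightarrow> 'a" where
  "eqz f g = (SOME e. is_equalizer S f g e)"

text \<open>The factorization of \<open>f\<close> through the monomorphism \<open>m\<close>.\<close>

definition lift :: "'a \<Rightarrow> 'a \<Rightarrow> 'a" where
  "lift m f = (THE u. u \<in> Hom S (Dom S f) (Dom S m) \<and> m \<cdot> u = f)"

definition comonoid :: "('o, 'a) comonoid \<Rightarrow> bool" where
  "comonoid K \<longleftrightarrow> obj K \<in> Ob S \<and>
     comult K \<in> Hom S (obj K) (obj K \<otimes>\<^sub>o obj K) \<and>
     counit K \<in> Hom S (obj K) (Unit S) \<and>
     (comult K \<otimes> \<one> (obj K)) \<cdot> comult K = (\<one> (obj K) \<otimes> comult K) \<cdot> comult K \<and>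
     (counit K \<otimes> \<one> (obj K)) \<cdot> comult K = \<one> (obj K) \<and>
     (\<one> (obj K) \<otimes> counit K) \<cdot> comult K = \<one> (obj K)"

definition comonoid_map :: "('o, 'a) comonoid \<Rightarrow> ('o, 'a) comonoid \<Rightarrow> 'a \<Rightarrow> bool" where
  "comonoid_map K L f \<longleftrightarrow> f \<in> Hom S (obj K) (obj L) \<and>
     comult L \<cdot> f = (f \<otimes> f) \<cdot> comult K \<and> counit L \<cdot> f = counit K"

definition unit0 :: "('o, 'a) comonoid" where
  "unit0 = \<lparr>obj = Unit S, comult = \<one> (Unit S), counit = \<one> (Unit S)\<rparr>"

definition op :: "('o, 'a) comonoid \<Rightarrow> ('o, 'a) comonoid" where
  "op K = \<lparr>obj = obj K, comult = Braid S (obj K) (obj K) \<cdot> comult K, counit = counit K\<rparr>"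

definition tens0 :: "('o, 'a) comonoid \<Rightarrow> ('o, 'a) comonoid \<Rightarrow> ('o, 'a) comonoid"
    (infixr "\<otimes>\<^sub>0" 70) where
  "K \<otimes>\<^sub>0 L = \<lparr>obj = obj K \<otimes>\<^sub>o obj L,
     comult = (\<one> (obj K) \<otimes> Braid S (obj K) (obj L) \<otimes> \<one> (obj L)) \<cdot> (comult K \<otimes> comult L),
     counit = counit K \<otimes> counit L\<rparr>"

definition comult3 :: "('o, 'a) comonoid \<Rightarrow> 'a" where
  "comult3 K = (comult K \<otimes> \<one> (obj K)) \<cdot> comult K"

definition cell1 :: "('o, 'a) comodule \<Rightarrow> bool" where
  "cell1 M \<longleftrightarrow> comonoid (src M) \<and> comonoid (tgt M) \<and> bimod M \<in> Ob S \<and>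
     coact M \<in> Hom S (bimod M) (obj (src M) \<otimes>\<^sub>o bimod M \<otimes>\<^sub>o obj (tgt M)) \<and>
     (counit (src M) \<otimes> \<one> (bimod M) \<otimes> counit (tgt M)) \<cdot> coact M = \<one> (bimod M) \<and>
     (comult (src M) \<otimes> \<one> (bimod M) \<otimes> comult (tgt M)) \<cdot> coact M =
     (\<one> (obj (src M)) \<otimes> coact M \<otimes> \<one> (obj (tgt M))) \<cdot> coact M"

definition cell2 :: "('o, 'a) comodule \<Rightarrow> ('o, 'a) comodule \<Rightarrow> 'a \<Rightarrow> bool" where
  "cell2 M N \<theta> \<longleftrightarrow> src M = src N \<and> tgt M = tgt N \<and> \<theta> \<in> Hom S (bimod M) (bimod N) \<and>
     coact N \<cdot> \<theta> = (\<one> (obj (src M)) \<otimes> \<theta> \<otimes> \<one> (obj (tgt M))) \<cdot> coact M"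

definition lcoact :: "('o, 'a) comodule \<Rightarrow> 'a" where
  "lcoact M = (\<one> (obj (src M)) \<otimes> \<one> (bimod M) \<otimes> counit (tgt M)) \<cdot> coact M"

definition rcoact :: "('o, 'a) comodule \<Rightarrow> 'a" where
  "rcoact M = (counit (src M) \<otimes> \<one> (bimod M) \<otimes> \<one> (obj (tgt M))) \<cdot> coact M"

text \<open>
  Composition is written in diagrammatic order: for \<open>M\<close> from \<open>E\<close> to \<open>C\<close> and \<open>N\<close> from \<open>C\<close> to \<open>F\<close>,
  \<open>M \<box> N = M \<otimes>\<^sub>C N\<close> is the composite \<open>N \<circ> M\<close>, with inclusion \<open>incl M N\<close> into \<open>M \<otimes> N\<close>.
\<close>

definition incl :: "('o, 'a) comodule \<Rightarrow> ('o, 'a) comodule \<Rightarrow> 'a" where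
  "incl M N = eqz (rcoact M \<otimes> \<one> (bimod N)) (\<one> (bimod M) \<otimes> lcoact N)"

definition comp1 :: "('o, 'a) comodule \<Rightarrow> ('o, 'a) comodule \<Rightarrow> ('o, 'a) comodule" (infixr "\<box>" 68) where
  "M \<box> N = \<lparr>src = src M, tgt = tgt N, bimod = Dom S (incl M N),
     coact = lift (\<one> (obj (src M)) \<otimes> incl M N \<otimes> \<one> (obj (tgt N))) ((lcoact M \<otimes> rcoact N) \<cdot> incl M N)\<rparr>"

definition id1 :: "('o, 'a) comonoid \<Rightarrow> ('o, 'a) comodule" where
  "id1 K = \<lparr>src = K, tgt = K, bimod = obj K, coact = comult3 K\<rparr>"

text \<open>Horizontal composition of \<open>\<theta> : M \<Rightarrow> M'\<close> and \<open>\<kappa> : N \<Rightarrow> N'\<close>, and the two whiskerings.\<close>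

definition hcomp :: "('o, 'a) comodule \<Rightarrow> ('o, 'a) comodule \<Rightarrow> ('o, 'a) comodule \<Rightarrow> ('o, 'a) comodule \<Rightarrow>
    'a \<Rightarrow> 'a \<Rightarrow> 'a" where
  "hcomp M M' N N' \<theta> \<kappa> = lift (incl M' N') ((\<theta> \<otimes> \<kappa>) \<cdot> incl M N)"

definition lwhisk :: "('o, 'a) comodule \<Rightarrow> ('o, 'a) comodule \<Rightarrow> ('o, 'a) comodule \<Rightarrow> 'a \<Rightarrow> 'a" where
  "lwhisk M N N' \<kappa> = hcomp M M N N' (\<one> (bimod M)) \<kappa>"

definition rwhisk :: "('o, 'a) comodule \<Rightarrow> ('o, 'a) comodule \<Rightarrow> ('o, 'a) comodule \<Rightarrow> 'a \<Rightarrow> 'a" where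
  "rwhisk M M' N \<theta> = hcomp M M' N N \<theta> (\<one> (bimod N))"

text \<open>
  The constraints \<open>(M \<box> N) \<box> P \<Rightarrow> M \<box> (N \<box> P)\<close>, \<open>1 \<box> M \<Rightarrow> M\<close> and \<open>M \<box> 1 \<Rightarrow> M\<close> of the bicategory;
  the first is the map compatible with the inclusions into \<open>M \<otimes> N \<otimes> P\<close>.
\<close>

definition asc :: "('o, 'a) comodule \<Rightarrow> ('o, 'a) comodule \<Rightarrow> ('o, 'a) comodule \<Rightarrow> 'a" where
  "asc M N P = lift ((\<one> (bimod M) \<otimes> incl N P) \<cdot> incl M (N \<box> P))
                    ((incl M N \<otimes> \<one> (bimod P)) \<cdot> incl (M \<box> N) P)"

definition lun :: "('o, 'a) comodule \<Rightarrow> 'a" where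
  "lun M = (counit (src M) \<otimes> \<one> (bimod M)) \<cdot> incl (id1 (src M)) M"

definition run :: "('o, 'a) comodule \<Rightarrow> 'a" where
  "run M = (\<one> (bimod M) \<otimes> counit (tgt M)) \<cdot> incl M (id1 (tgt M))"

definition tens1 :: "('o, 'a) comodule \<Rightarrow> ('o, 'a) comodule \<Rightarrow> ('o, 'a) comodule" (infixr "\<otimes>\<^sub>1" 70) where
  "M \<otimes>\<^sub>1 N = \<lparr>src = src M \<otimes>\<^sub>0 src N, tgt = tgt M \<otimes>\<^sub>0 tgt N, bimod = bimod M \<otimes>\<^sub>o bimod N,
     coact =
       (\<one> (obj (src M)) \<otimes> \<one> (obj (src N)) \<otimes> \<one> (bimod M) \<otimes>
          Braid S (obj (tgt M)) (bimod N) \<otimes> \<one> (obj (tgt N))) \<cdot>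
       (\<one> (obj (src M)) \<otimes> Braid S (bimod M \<otimes>\<^sub>o obj (tgt M)) (obj (src N)) \<otimes>
          \<one> (bimod N) \<otimes> \<one> (obj (tgt N))) \<cdot>
       (coact M \<otimes> coact N)\<rparr>"

text \<open>
  The interchange constraint \<open>(M \<box> M') \<otimes> (N \<box> N') \<Rightarrow> (M \<otimes> N) \<box> (M' \<otimes> N')\<close> of the tensor product,
  induced by the braiding \<open>M \<otimes> M' \<otimes> N \<otimes> N' \<rightarrow> M \<otimes> N \<otimes> M' \<otimes> N'\<close>.
\<close>

definition ich :: "('o, 'a) comodule \<Rightarrow> ('o, 'a) comodule \<Rightarrow> ('o, 'a) comodule \<Rightarrow> ('o, 'a) comodule \<Rightarrow> 'a" where
  "ich M N M' N' = lift (incl (M \<otimes>\<^sub>1 N) (M' \<otimes>\<^sub>1 N'))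
     ((\<one> (bimod M) \<otimes> Braid S (bimod M') (bimod N) \<otimes> \<one> (bimod N')) \<cdot> (incl M M' \<otimes> incl N N'))"

definition comonad :: "('o, 'a) comonoid \<Rightarrow> ('o, 'a) comodule \<Rightarrow> 'a \<Rightarrow> 'a \<Rightarrow> bool" where
  "comonad K G d e \<longleftrightarrow> cell1 G \<and> src G = K \<and> tgt G = K \<and>
     cell2 G (G \<box> G) d \<and> cell2 G (id1 K) e \<and>
     asc G G G \<cdot> rwhisk G (G \<box> G) G d \<cdot> d = lwhisk G G (G \<box> G) d \<cdot> d \<and>
     lun G \<cdot> rwhisk G (id1 K) G e \<cdot> d = \<one> (bimod G) \<and>
     run G \<cdot> lwhisk G G (id1 K) e \<cdot> d = \<one> (bimod G)"

text \<open>
  \<open>(k, \<kappa>)\<close> is a comonad map from \<open>(B, (G, d, e))\<close> to \<open>(B', (G', d', e'))\<close>; in diagrammatic order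
  \<open>\<kappa> : G \<box> k \<Rightarrow> k \<box> G'\<close>.
\<close>

definition comonad_map :: "('o, 'a) comodule \<Rightarrow> 'a \<Rightarrow> 'a \<Rightarrow> ('o, 'a) comodule \<Rightarrow> 'a \<Rightarrow> 'a \<Rightarrow>
    ('o, 'a) comodule \<Rightarrow> 'a \<Rightarrow> bool" where
  "comonad_map G d e G' d' e' k \<kappa> \<longleftrightarrow> cell1 k \<and> src k = src G \<and> tgt k = src G' \<and>
     cell2 (G \<box> k) (k \<box> G') \<kappa> \<and>
     asc k G' G' \<cdot> rwhisk (G \<box> k) (k \<box> G') G' \<kappa> \<cdot> Inv S (asc G k G') \<cdot>
       lwhisk G (G \<box> k) (k \<box> G') \<kappa> \<cdot> asc G G k \<cdot> rwhisk G (G \<box> G) k d =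
     lwhisk k G' (G' \<box> G') d' \<cdot> \<kappa> \<and>
     run k \<cdot> lwhisk k G' (id1 (src G')) e' \<cdot> \<kappa> = lun k \<cdot> rwhisk G (id1 (src G)) k e"

definition slide :: "('o, 'a) comodule \<Rightarrow> 'a" where
  "slide M = Inv S (lun M) \<cdot> run M"

text \<open>
  \<open>(A, m2, m0)\<close> is a lax monoidal endomorphism of the monoidale \<open>X\<close>, where
  \<open>m2 : (A \<otimes> A) \<box> p \<Rightarrow> p \<box> A\<close> and \<open>m0 : j \<Rightarrow> j \<box> A\<close>.
\<close>

definition monoidal_endo :: "('o, 'a) monoidale \<Rightarrow> ('o, 'a) comodule \<Rightarrow> 'a \<Rightarrow> 'a \<Rightarrow> bool" where
  "monoidal_endo X A m2 m0 \<longleftrightarrow>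
    (let p = mmul X; j = munit X; i = id1 (mob X); u = id1 unit0;
         AA = A \<otimes>\<^sub>1 A; AAA = A \<otimes>\<^sub>1 A \<otimes>\<^sub>1 A;
         pl = p \<otimes>\<^sub>1 i; pr = i \<otimes>\<^sub>1 p; jl = j \<otimes>\<^sub>1 i; jr = i \<otimes>\<^sub>1 j;
         m2l = ich p i A A \<cdot> (m2 \<otimes> slide A) \<cdot> Inv S (ich AA A p i);
         m2r = ich i p A A \<cdot> (slide A \<otimes> m2) \<cdot> Inv S (ich A AA i p);
         m0l = ich j i A A \<cdot> ((m0 \<cdot> lun j) \<otimes> slide A) \<cdot> Inv S (ich u A j i);
         m0r = ich i j A A \<cdot> (slide A \<otimes> (m0 \<cdot> lun j)) \<cdot> Inv S (ich A u i j)
     in cell1 A \<and> src A = mob X \<and> tgt A = mob X \<and>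
        cell2 (AA \<box> p) (p \<box> A) m2 \<and> cell2 j (j \<box> A) m0 \<and>
        rwhisk (pl \<box> p) (pr \<box> p) A (massoc X) \<cdot> Inv S (asc pl p A) \<cdot>
          lwhisk pl (AA \<box> p) (p \<box> A) m2 \<cdot> asc pl AA p \<cdot>
          rwhisk (AAA \<box> pl) (pl \<box> AA) p m2l \<cdot> Inv S (asc AAA pl p) =
        Inv S (asc pr p A) \<cdot> lwhisk pr (AA \<box> p) (p \<box> A) m2 \<cdot> asc pr AA p \<cdot>
          rwhisk (AAA \<box> pr) (pr \<box> AA) p m2r \<cdot> Inv S (asc AAA pr p) \<cdot>
          lwhisk AAA (pl \<box> p) (pr \<box> p) (massoc X) \<and>
        lun A \<cdot> rwhisk (jl \<box> p) i A (mlunit X) \<cdot> Inv S (asc jl p A) \<cdot>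
          lwhisk jl (AA \<box> p) (p \<box> A) m2 \<cdot> asc jl AA p \<cdot>
          rwhisk (A \<box> jl) (jl \<box> AA) p m0l \<cdot> Inv S (asc A jl p) =
        run A \<cdot> lwhisk A (jl \<box> p) i (mlunit X) \<and>
        lun A \<cdot> rwhisk (jr \<box> p) i A (mrunit X) \<cdot> Inv S (asc jr p A) \<cdot>
          lwhisk jr (AA \<box> p) (p \<box> A) m2 \<cdot> asc jr AA p \<cdot>
          rwhisk (A \<box> jr) (jr \<box> AA) p m0r \<cdot> Inv S (asc A jr p) =
        run A \<cdot> lwhisk A (jr \<box> p) i (mrunit X))"

definition enrich :: "('o, 'a) comonoid \<Rightarrow> ('o, 'a) comonoid" where
  "enrich K = op K \<otimes>\<^sub>0 K"

definition ev :: "('o, 'a) comonoid \<Rightarrow> ('o, 'a) comodule" where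
  "ev K = \<lparr>src = K \<otimes>\<^sub>0 op K, tgt = unit0, bimod = obj K,
     coact = (\<one> (obj K) \<otimes> Braid S (obj K) (obj K)) \<cdot> comult3 K\<rparr>"

definition coev :: "('o, 'a) comonoid \<Rightarrow> ('o, 'a) comodule" where
  "coev K = \<lparr>src = unit0, tgt = enrich K, bimod = obj K,
     coact = (Braid S (obj K) (obj K) \<otimes> \<one> (obj K)) \<cdot> comult3 K\<rparr>"

definition pmul :: "('o, 'a) comonoid \<Rightarrow> ('o, 'a) comodule" where
  "pmul K = id1 (op K) \<otimes>\<^sub>1 ev K \<otimes>\<^sub>1 id1 K"

text \<open>
  The triangle isomorphisms \<open>(e \<otimes> C) \<circ> (C \<otimes> j) \<cong> 1\<close> and \<open>(C\<^sup>o \<otimes> e) \<circ> (j \<otimes> C\<^sup>o) \<cong> 1\<close>, induced by the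
  counits of three of the four tensor factors \<open>C\<close>. A map of bicomodules into an identity 1-cell is
  determined by its composite with the counit, here the counit of all four factors.
\<close>

definition tri :: "('o, 'a) comonoid \<Rightarrow> 'a" where
  "tri K = (\<one> (obj K) \<otimes> counit K \<otimes> counit K \<otimes> counit K) \<cdot> incl (id1 K \<otimes>\<^sub>1 coev K) (ev K \<otimes>\<^sub>1 id1 K)"

definition tri_op :: "('o, 'a) comonoid \<Rightarrow> 'a" where
  "tri_op K = (counit K \<otimes> \<one> (obj K) \<otimes> counit K \<otimes> counit K) \<cdot>
     incl (coev K \<otimes>\<^sub>1 id1 (op K)) (id1 (op K) \<otimes>\<^sub>1 ev K)"

text \<open>
  Associativity \<open>p \<circ> (p \<otimes> 1) \<cong> p \<circ> (1 \<otimes> p)\<close>: by interchange both sides are isomorphic to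
  \<open>C\<^sup>o \<otimes> e \<otimes> e \<otimes> C\<close>. The unit constraints \<open>p \<circ> (j \<otimes> 1) \<cong> 1\<close> and \<open>p \<circ> (1 \<otimes> j) \<cong> 1\<close> are
  \<open>tri_op K \<otimes> C\<close> and \<open>C\<^sup>o \<otimes> tri K\<close> up to interchange.
\<close>

definition pmonoidale :: "('o, 'a) comonoid \<Rightarrow> ('o, 'a) monoidale" where
  "pmonoidale K =
    (let o1 = id1 (op K); c1 = id1 K; x = o1 \<otimes>\<^sub>1 ev K; y = ev K \<otimes>\<^sub>1 c1;
         assl = (run x \<otimes> lun y) \<cdot> Inv S (ich x (id1 (K \<otimes>\<^sub>0 op K \<otimes>\<^sub>0 K)) o1 y);
         assr = (lun x \<otimes> run y) \<cdot> Inv S (ich (id1 (op K \<otimes>\<^sub>0 K \<otimes>\<^sub>0 op K)) y x c1)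
     in \<lparr>mob = enrich K, mmul = pmul K, munit = coev K,
          massoc = Inv S assr \<cdot> assl,
          mlunit = (tri_op K \<otimes> lun c1) \<cdot> Inv S (ich (coev K \<otimes>\<^sub>1 o1) c1 x c1),
          mrunit = (lun o1 \<otimes> tri K) \<cdot> Inv S (ich o1 (c1 \<otimes>\<^sub>1 coev K) o1 y)\<rparr>)"

text \<open>
  The comonoid structure on the object of \<open>A\<close> and the comonoid maps \<open>s : A \<rightarrow> C\<^sup>o\<close> and
  \<open>t : A \<rightarrow> C\<close> which correspond to the comonad \<open>A\<close> on \<open>C\<^sup>o \<otimes> C\<close>, whose counit is \<open>(s \<otimes> t) \<delta>\<close>.
\<close>

definition arrows :: "('o, 'a) qcat \<Rightarrow> ('o, 'a) comonoid" where
  "arrows Q = \<lparr>obj = bimod (edge Q), comult = incl (edge Q) (edge Q) \<cdot> cmult Q,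
     counit = counit (enrich (base Q)) \<cdot> ccounit Q\<rparr>"

definition source :: "('o, 'a) qcat \<Rightarrow> 'a" where
  "source Q = (\<one> (obj (base Q)) \<otimes> counit (base Q)) \<cdot> ccounit Q"

definition target :: "('o, 'a) qcat \<Rightarrow> 'a" where
  "target Q = (counit (base Q) \<otimes> \<one> (obj (base Q))) \<cdot> ccounit Q"

text \<open>
  For \<open>s, t : A \<rightarrow> C\<close>, the object \<open>A\<close> has the left coaction \<open>c\<^sup>-\<^sup>1 (1 \<otimes> s) \<delta>\<close> and the right coaction
  \<open>(1 \<otimes> t) \<delta>\<close>; \<open>pairs A s t\<close> is the inclusion of \<open>A \<otimes>\<^sub>C A\<close> into \<open>A \<otimes> A\<close>.
\<close>

definition pairs :: "('o, 'a) comonoid \<Rightarrow> 'a \<Rightarrow> 'a \<Rightarrow> 'a" where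
  "pairs A s t = eqz
     (((\<one> (obj A) \<otimes> t) \<cdot> comult A) \<otimes> \<one> (obj A))
     (\<one> (obj A) \<otimes> (Inv S (Braid S (Cod S s) (obj A)) \<cdot> (\<one> (obj A) \<otimes> s) \<cdot> comult A))"

definition composable :: "('o, 'a) qcat \<Rightarrow> 'a" where
  "composable Q = pairs (arrows Q) (source Q) (target Q)"

text \<open>
  The canonical isomorphisms of \<open>p \<circ> (A \<otimes> A)\<close> with \<open>H = A \<otimes>\<^sub>C A\<close> and of \<open>A \<circ> p\<close> with \<open>C \<otimes> A\<close>.
  They are obtained by applying counits inside
  \<open>A \<otimes> A \<otimes> (C \<otimes> C \<otimes> C)\<close> and \<open>(C \<otimes> C \<otimes> C) \<otimes> A\<close>.
\<close>

definition to_pairs :: "('o, 'a) qcat \<Rightarrow> 'a" where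
  "to_pairs Q = (let A = edge Q; C = base Q in
     lift (composable Q)
       ((\<one> (bimod A) \<otimes> \<one> (bimod A) \<otimes> counit C \<otimes> counit C \<otimes> counit C) \<cdot> incl (A \<otimes>\<^sub>1 A) (pmul C)))"

definition to_tensor :: "('o, 'a) qcat \<Rightarrow> 'a" where
  "to_tensor Q = (let A = edge Q; C = base Q in
     (counit C \<otimes> \<one> (obj C) \<otimes> counit C \<otimes> \<one> (bimod A)) \<cdot> incl (pmul C) A)"

definition quantum_graph :: "('o, 'a) qcat \<Rightarrow> bool" where
  "quantum_graph Q \<longleftrightarrow> comonoid (base Q) \<and> comonad (enrich (base Q)) (edge Q) (cmult Q) (ccounit Q)"

text \<open>
  The component \<open>mu2\<close> is given as a map \<open>H \<rightarrow> C \<otimes> A\<close>; \<open>m2\<close> is the corresponding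
  2-cell \<open>p \<circ> (A \<otimes> A) \<Rightarrow> A \<circ> p\<close>. The comonad map \<open>(j, mu0)\<close> starts at the identity comonad on \<open>I\<close>.
\<close>

definition quantum_category :: "('o, 'a) qcat \<Rightarrow> bool" where
  "quantum_category Q \<longleftrightarrow> quantum_graph Q \<and>
    (let A = edge Q; d = cmult Q; e = ccounit Q; p = pmul (base Q); j = coev (base Q); u = id1 unit0
     in mu2 Q \<in> Hom S (Dom S (composable Q)) (obj (base Q) \<otimes>\<^sub>o bimod A) \<and>
        (\<exists>m2. cell2 ((A \<otimes>\<^sub>1 A) \<box> p) (p \<box> A) m2 \<and> to_tensor Q \<cdot> m2 = mu2 Q \<cdot> to_pairs Q \<and>
           monoidal_endo (pmonoidale (base Q)) A m2 (mu0 Q) \<and>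
           comonad_map (A \<otimes>\<^sub>1 A) (ich A A A A \<cdot> (d \<otimes> d)) (e \<otimes> e) A d e p m2 \<and>
           comonad_map u (Inv S (lun u)) (\<one> (Unit S)) A d e j (mu0 Q \<cdot> lun j)))"

definition nu2 :: "('o, 'a) qcat \<Rightarrow> 'a" where
  "nu2 Q = (counit (base Q) \<otimes> \<one> (bimod (edge Q))) \<cdot> mu2 Q"

definition nu0 :: "('o, 'a) qcat \<Rightarrow> 'a" where
  "nu0 Q = (counit (base Q) \<otimes> \<one> (bimod (edge Q))) \<cdot> incl (coev (base Q)) (edge Q) \<cdot> mu0 Q"

text \<open>
  In the last equation \<open>h\<close> is the inclusion of \<open>A \<otimes>\<^bsub>C'\<^esub> A\<close>; the first \<open>lift\<close> is
  \<open>\<phi> \<otimes>\<^bsub>C'\<^esub> \<phi>\<close> and the second is \<open>\<iota>\<close>.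
\<close>

definition quantum_functor :: "('o, 'a) qcat \<Rightarrow> ('o, 'a) qcat \<Rightarrow> 'a \<Rightarrow> 'a \<Rightarrow> bool" where
  "quantum_functor Q Q' f \<phi> \<longleftrightarrow>
     comonoid_map (base Q) (base Q') f \<and> comonoid_map (arrows Q) (arrows Q') \<phi> \<and>
     source Q' \<cdot> \<phi> = f \<cdot> source Q \<and> target Q' \<cdot> \<phi> = f \<cdot> target Q \<and>
     \<phi> \<cdot> nu0 Q = nu0 Q' \<cdot> f \<and>
     (let h = pairs (arrows Q) (source Q' \<cdot> \<phi>) (target Q' \<cdot> \<phi>)
      in \<phi> \<cdot> nu2 Q = nu2 Q' \<cdot> lift (composable Q') ((\<phi> \<otimes> \<phi>) \<cdot> h) \<cdot> lift h (composable Q))"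

end


section \<open>The category of quantum categories\<close>

text \<open>
  The singleton conditions say that \<open>C\<close> and \<open>A\<close> are objects of \<open>V\<close>.
  Arrows of \<open>qCat V\<close> carry their domain and codomain.
\<close>

definition qcats :: "('o, 'a, 'm) bmc_scheme \<Rightarrow> ('o list, 'o list \<times> 'a \<times> 'o list) qcat set" where
  "qcats V = {Q. tensor_data.quantum_category (strictify V) Q \<and>
     (\<exists>x \<in> Ob V. obj (base Q) = [x]) \<and> (\<exists>a \<in> Ob V. bimod (edge Q) = [a])}"

definition qCat :: "('o, 'a, 'm) bmc_scheme \<Rightarrow>
    (('o list, 'o list \<times> 'a \<times> 'o list) qcat,
     ('o list, 'o list \<times> 'a \<times> 'o list) qcat \<times>
     (('o list \<times> 'a \<times> 'o list) \<times> ('o list \<times> 'a \<times> 'o list)) \<times>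
     ('o list, 'o list \<times> 'a \<times> 'o list) qcat) cat" where
  "qCat V = (let S = strictify V in
    \<lparr> Ob = qcats V,
      Ar = {(Q, (f, \<phi>), Q'). Q \<in> qcats V \<and> Q' \<in> qcats V \<and> tensor_data.quantum_functor S Q Q' f \<phi>},
      Dom = (\<lambda>(Q, F, Q'). Q),
      Cod = (\<lambda>(Q, F, Q'). Q'),
      Id = (\<lambda>Q. (Q, (\<one>\<^bsub>S\<^esub> (obj (base Q)), \<one>\<^bsub>S\<^esub> (bimod (edge Q))), Q)),
      Comp = (\<lambda>(P, (f', \<phi>'), Q'') (Q, (f, \<phi>), Q'). (Q, (f' \<cdot>\<^bsub>S\<^esub> f, \<phi>' \<cdot>\<^bsub>S\<^esub> \<phi>), Q'')) \<rparr>)"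

end

theory Submission
  imports Defs
begin

text \<open>
  Coherence makes the strictification of \<open>V\<close> a strict monoidal category whose braiding is natural
  and trivial on the unit; equalizers of coreflexive pairs lift to it from \<open>V\<close>. The counit of
  \<open>C\<close> makes the pair defining a cotensor product over \<open>C\<close> coreflexive, so every
  cotensor product in sight is a genuine equalizer. Consequently \<open>(\<phi> \<otimes>\<^bsub>C'\<^esub> \<phi>) \<iota>\<close> is the only map
  \<open>A \<otimes>\<^sub>C A \<rightarrow> A' \<otimes>\<^bsub>C'\<^esub> A'\<close> compatible with \<open>\<phi> \<otimes> \<phi>\<close>, hence it is functorial in \<open>\<phi>\<close>.
\<close>

section \<open>Coherence in braided monoidal categories\<close>

text \<open>The definitions rest on \<open>eqz\<close>, a choice, and \<open>lift\<close>, a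
  definite description. Both are informative only where an equalizer exists, and existence is
  available for coreflexive pairs alone. So most of the work is to show that each
  \<open>lift\<close> in the definition of a functor is legitimate. A retraction for the pair
  defining \<open>A\<close> tensored with itself over \<open>C\<close> requires counit laws for the
  two coactions of \<open>A\<close>. But the comultiplication of \<open>arrows Q\<close> is
  \<open>incl\<close> after \<open>cmult\<close>, so its counit law must be extracted from that of a
  comonad in the bicategory, where whiskering is itself a \<open>lift\<close>. Hence cotensor
  products over \<open>enrich C\<close> must be treated before those over \<open>C\<close>; there
  the retractions come from the counit laws of 1-cells and comonoids. The other obstacle is that the
  tensor of arrows in the strictification is conjugated by \<open>merge\<close>, so its strictness
  is a theorem about pentagon, triangle and their consequences for the unit.\<close>

context category
begin

section \<open>Categories: typing rules, isomorphisms, cancellation\<close>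

lemma Hom_iff: "f \<in> Hom V x y \<longleftrightarrow> f \<in> Ar V \<and> Dom V f = x \<and> Cod V f = y"
  by (auto simp: Hom_def)

lemma HomI [intro]: "f \<in> Ar V \<Longrightarrow> Dom V f = x \<Longrightarrow> Cod V f = y \<Longrightarrow> f \<in> Hom V x y"
  by (simp add: Hom_iff)

lemma HomD:
  assumes "f \<in> Hom V x y"
  shows "f \<in> Ar V" "Dom V f = x" "Cod V f = y" "x \<in> Ob V" "y \<in> Ob V"
  using assms Dom_Ob Cod_Ob by (auto simp: Hom_iff)

declare Dom_Ob [simp] Cod_Ob [simp]

lemma Id_Ar [simp]: "x \<in> Ob V \<Longrightarrow> \<one> x \<in> Ar V"
  and Dom_Id [simp]: "x \<in> Ob V \<Longrightarrow> Dom V (\<one> x) = x"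
  and Cod_Id [simp]: "x \<in> Ob V \<Longrightarrow> Cod V (\<one> x) = x"
  using Id_Hom by (auto simp: Hom_iff)

lemma Comp_Ar [simp]: "f \<in> Ar V \<Longrightarrow> g \<in> Ar V \<Longrightarrow> Cod V f = Dom V g \<Longrightarrow> g \<cdot> f \<in> Ar V"
  and Dom_Comp [simp]: "f \<in> Ar V \<Longrightarrow> g \<in> Ar V \<Longrightarrow> Cod V f = Dom V g \<Longrightarrow> Dom V (g \<cdot> f) = Dom V f"
  and Cod_Comp [simp]: "f \<in> Ar V \<Longrightarrow> g \<in> Ar V \<Longrightarrow> Cod V f = Dom V g \<Longrightarrow> Cod V (g \<cdot> f) = Cod V g"
  using Comp_Hom[of f "Dom V f" "Cod V f" g "Cod V g"] by (auto simp: Hom_iff)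

lemma Comp_Id [simp]: "f \<in> Ar V \<Longrightarrow> Dom V f = x \<Longrightarrow> f \<cdot> \<one> x = f"
  and Id_Comp [simp]: "f \<in> Ar V \<Longrightarrow> Cod V f = x \<Longrightarrow> \<one> x \<cdot> f = f"
  using Comp_Id_right[of f x "Cod V f"] Comp_Id_left[of f "Dom V f" x] by (auto simp: Hom_iff)

lemma Comp_assoc' [simp]: "f \<in> Ar V \<Longrightarrow> g \<in> Ar V \<Longrightarrow> h \<in> Ar V \<Longrightarrow> Cod V f = Dom V g \<Longrightarrow>
    Cod V g = Dom V h \<Longrightarrow> (h \<cdot> g) \<cdot> f = h \<cdot> g \<cdot> f"
  using Comp_assoc[of f "Dom V f" "Cod V f" g "Cod V g" h "Cod V h"] by (simp add: Hom_iff)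

text \<open>Simp brackets composites to the right, so the left side of a commuting square is no
  longer a subterm once an arrow \<open>z\<close> stands to its right. This is the square with such
  a tail.\<close>

lemma Comp_square:
  "g \<cdot> f = k \<cdot> h \<Longrightarrow> z \<in> Ar V \<Longrightarrow> f \<in> Ar V \<Longrightarrow> g \<in> Ar V \<Longrightarrow> h \<in> Ar V \<Longrightarrow> k \<in> Ar V \<Longrightarrow>
    Cod V z = Dom V f \<Longrightarrow> Cod V f = Dom V g \<Longrightarrow> Dom V h = Dom V f \<Longrightarrow> Cod V h = Dom V k \<Longrightarrow>
    g \<cdot> f \<cdot> z = k \<cdot> h \<cdot> z"
  by (metis Comp_assoc')

text \<open>Gives meaning to the definite description in \<open>Inv\<close>.\<close>

lemma inverse_arrows_unique:
  assumes "inverse_arrows V f g" "inverse_arrows V f h"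
  shows "g = h"
proof -
  have "g = g \<cdot> f \<cdot> h" using assms by (auto simp: inverse_arrows_def Hom_iff)
  also have "\<dots> = (g \<cdot> f) \<cdot> h" using assms by (subst Comp_assoc') (auto simp: inverse_arrows_def Hom_iff)
  also have "\<dots> = h" using assms by (auto simp: inverse_arrows_def Hom_iff)
  finally show ?thesis .
qed

lemma Inv_eqI: "inverse_arrows V f g \<Longrightarrow> Inv V f = g"
  unfolding Inv_def using inverse_arrows_unique by blast

lemma inverse_arrows_Inv: "is_iso V f \<Longrightarrow> inverse_arrows V f (Inv V f)"
  using Inv_eqI by (auto simp: is_iso_def)

lemma is_iso_Ar: "is_iso V f \<Longrightarrow> f \<in> Ar V"
  by (auto simp: is_iso_def inverse_arrows_def)

lemma Inv_Ar [simp]: "is_iso V f \<Longrightarrow> Inv V f \<in> Ar V"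
  and Dom_Inv [simp]: "is_iso V f \<Longrightarrow> Dom V (Inv V f) = Cod V f"
  and Cod_Inv [simp]: "is_iso V f \<Longrightarrow> Cod V (Inv V f) = Dom V f"
  and Inv_left [simp]: "is_iso V f \<Longrightarrow> Inv V f \<cdot> f = \<one> (Dom V f)"
  and Inv_right [simp]: "is_iso V f \<Longrightarrow> f \<cdot> Inv V f = \<one> (Cod V f)"
  using inverse_arrows_Inv[of f] by (auto simp: inverse_arrows_def Hom_iff)

lemma Inv_left' [simp]:
  "is_iso V f \<Longrightarrow> z \<in> Ar V \<Longrightarrow> Cod V z = Dom V f \<Longrightarrow> Inv V f \<cdot> f \<cdot> z = z"
  by (subst Comp_assoc'[symmetric]) (auto simp: is_iso_Ar)

lemma Inv_right' [simp]:
  "is_iso V f \<Longrightarrow> z \<in> Ar V \<Longrightarrow> Cod V z = Cod V f \<Longrightarrow> f \<cdot> Inv V f \<cdot> z = z"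
  by (subst Comp_assoc'[symmetric]) (auto simp: is_iso_Ar)

lemma is_isoI:
  "f \<in> Ar V \<Longrightarrow> g \<in> Ar V \<Longrightarrow> Dom V g = Cod V f \<Longrightarrow> Cod V g = Dom V f \<Longrightarrow>
    g \<cdot> f = \<one> (Dom V f) \<Longrightarrow> f \<cdot> g = \<one> (Cod V f) \<Longrightarrow> is_iso V f"
  unfolding is_iso_def inverse_arrows_def by auto

lemma is_iso_Id [simp]: "x \<in> Ob V \<Longrightarrow> is_iso V (\<one> x)"
  by (rule is_isoI[of _ "\<one> x"]) auto

lemma is_iso_Inv [simp]: "is_iso V f \<Longrightarrow> is_iso V (Inv V f)"
  by (rule is_isoI[of _ f]) (auto simp: is_iso_Ar)

lemma is_iso_Comp [simp]:
  "is_iso V f \<Longrightarrow> is_iso V g \<Longrightarrow> Cod V f = Dom V g \<Longrightarrow> is_iso V (g \<cdot> f)"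
  by (rule is_isoI[of _ "Inv V f \<cdot> Inv V g"]) (auto simp: is_iso_Ar)

lemma iso_cancel_left:
  assumes "m \<cdot> f = m \<cdot> g" "is_iso V m" "f \<in> Ar V" "g \<in> Ar V" "Cod V f = Dom V m" "Cod V g = Dom V m"
  shows "f = g"
  using assms Inv_left' by metis

lemma iso_cancel_right:
  assumes "f \<cdot> m = g \<cdot> m" "is_iso V m" "f \<in> Ar V" "g \<in> Ar V" "Dom V f = Cod V m" "Dom V g = Cod V m"
  shows "f = g"
proof -
  have "f = (f \<cdot> m) \<cdot> Inv V m" using assms(2-) by (simp add: is_iso_Ar)
  also have "\<dots> = (g \<cdot> m) \<cdot> Inv V m" by (simp only: assms(1))
  also have "\<dots> = g" using assms(2-) by (simp add: is_iso_Ar)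
  finally show ?thesis .
qed

lemma Inv_Id [simp]: "x \<in> Ob V \<Longrightarrow> Inv V (\<one> x) = \<one> x"
  by (rule Inv_eqI) (auto simp: inverse_arrows_def)

end


section \<open>Coherence of the unit isomorphisms and of the braiding at the unit\<close>

context braided_monoidal_category
begin

declare Unit_Ob [simp] TensO_Ob [simp] TensA_Id [simp]

lemma TensA_Ar [simp]: "f \<in> Ar V \<Longrightarrow> g \<in> Ar V \<Longrightarrow> f \<otimes> g \<in> Ar V"
  and Dom_TensA [simp]: "f \<in> Ar V \<Longrightarrow> g \<in> Ar V \<Longrightarrow> Dom V (f \<otimes> g) = Dom V f \<otimes>\<^sub>o Dom V g"
  and Cod_TensA [simp]: "f \<in> Ar V \<Longrightarrow> g \<in> Ar V \<Longrightarrow> Cod V (f \<otimes> g) = Cod V f \<otimes>\<^sub>o Cod V g"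
  using TensA_Hom[of f "Dom V f" "Cod V f" g "Dom V g" "Cod V g"] by (auto simp: Hom_iff)

lemma interchange [simp]:
  "f \<in> Ar V \<Longrightarrow> f' \<in> Ar V \<Longrightarrow> g \<in> Ar V \<Longrightarrow> g' \<in> Ar V \<Longrightarrow> Cod V f = Dom V f' \<Longrightarrow> Cod V g = Dom V g' \<Longrightarrow>
    (f' \<otimes> g') \<cdot> (f \<otimes> g) = (f' \<cdot> f) \<otimes> (g' \<cdot> g)"
  using TensA_Comp[of f "Dom V f" "Cod V f" f' "Cod V f'" g "Dom V g" "Cod V g" g' "Cod V g'"]
  by (auto simp: Hom_iff)

text \<open>Interchange is oriented towards one tensor of composites; the tail \<open>z\<close>
  accounts for right bracketing. Calculations that need a naturality square switch both rules
  off.\<close>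

lemma interchange' [simp]:
  "f \<in> Ar V \<Longrightarrow> f' \<in> Ar V \<Longrightarrow> g \<in> Ar V \<Longrightarrow> g' \<in> Ar V \<Longrightarrow> Cod V f = Dom V f' \<Longrightarrow> Cod V g = Dom V g' \<Longrightarrow>
    z \<in> Ar V \<Longrightarrow> Cod V z = Dom V f \<otimes>\<^sub>o Dom V g \<Longrightarrow>
    (f' \<otimes> g') \<cdot> (f \<otimes> g) \<cdot> z = ((f' \<cdot> f) \<otimes> (g' \<cdot> g)) \<cdot> z"
  by (subst Comp_assoc'[symmetric]) auto

lemma Assoc_simps [simp]:
  assumes "x \<in> Ob V" "y \<in> Ob V" "z \<in> Ob V"
  shows "Assoc V x y z \<in> Ar V" "Dom V (Assoc V x y z) = (x \<otimes>\<^sub>o y) \<otimes>\<^sub>o z"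
    "Cod V (Assoc V x y z) = x \<otimes>\<^sub>o y \<otimes>\<^sub>o z" "is_iso V (Assoc V x y z)"
  using Assoc_Hom[OF assms] by (auto simp: Hom_iff)

lemma LU_simps [simp]:
  assumes "x \<in> Ob V"
  shows "LU V x \<in> Ar V" "Dom V (LU V x) = Unit V \<otimes>\<^sub>o x" "Cod V (LU V x) = x" "is_iso V (LU V x)"
  using LU_Hom[OF assms] by (auto simp: Hom_iff)

lemma RU_simps [simp]:
  assumes "x \<in> Ob V"
  shows "RU V x \<in> Ar V" "Dom V (RU V x) = x \<otimes>\<^sub>o Unit V" "Cod V (RU V x) = x" "is_iso V (RU V x)"
  using RU_Hom[OF assms] by (auto simp: Hom_iff)

lemma Braid_simps [simp]:
  assumes "x \<in> Ob V" "y \<in> Ob V"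
  shows "Braid V x y \<in> Ar V" "Dom V (Braid V x y) = x \<otimes>\<^sub>o y" "Cod V (Braid V x y) = y \<otimes>\<^sub>o x"
    "is_iso V (Braid V x y)"
  using Braid_Hom[OF assms] by (auto simp: Hom_iff)

lemma is_iso_TensA [simp]: "is_iso V f \<Longrightarrow> is_iso V g \<Longrightarrow> is_iso V (f \<otimes> g)"
  by (rule is_isoI[of _ "Inv V f \<otimes> Inv V g"]) (auto simp: is_iso_Ar)

lemma Assoc_nat:
  "f \<in> Ar V \<Longrightarrow> g \<in> Ar V \<Longrightarrow> h \<in> Ar V \<Longrightarrow>
    Assoc V (Cod V f) (Cod V g) (Cod V h) \<cdot> ((f \<otimes> g) \<otimes> h) =
    (f \<otimes> g \<otimes> h) \<cdot> Assoc V (Dom V f) (Dom V g) (Dom V h)"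
  using Assoc_natural by (auto simp: Hom_iff)

lemma LU_nat: "f \<in> Ar V \<Longrightarrow> LU V (Cod V f) \<cdot> (\<one> (Unit V) \<otimes> f) = f \<cdot> LU V (Dom V f)"
  using LU_natural by (auto simp: Hom_iff)

lemma RU_nat: "f \<in> Ar V \<Longrightarrow> RU V (Cod V f) \<cdot> (f \<otimes> \<one> (Unit V)) = f \<cdot> RU V (Dom V f)"
  using RU_natural by (auto simp: Hom_iff)

lemma Braid_nat: "f \<in> Ar V \<Longrightarrow> g \<in> Ar V \<Longrightarrow>
    Braid V (Cod V f) (Cod V g) \<cdot> (f \<otimes> g) = (g \<otimes> f) \<cdot> Braid V (Dom V f) (Dom V g)"
  using Braid_natural by (auto simp: Hom_iff)

text \<open>By naturality of the invertible \<open>LU\<close>, \<open>f\<close> is determined by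
  \<open>1 \<otimes> f\<close>. Identities about the unit can thus be proved after tensoring with
  it, where pentagon and triangle apply.\<close>

lemma Unit_TensA_cancel:
  assumes "\<one> (Unit V) \<otimes> f = \<one> (Unit V) \<otimes> g" "f \<in> Ar V" "g \<in> Ar V" "Dom V f = Dom V g" "Cod V f = Cod V g"
  shows "f = g"
proof (rule iso_cancel_right)
  show "f \<cdot> LU V (Dom V f) = g \<cdot> LU V (Dom V f)"
    using assms LU_nat by metis
qed (use assms in auto)

lemma TensA_Unit_cancel:
  assumes "f \<otimes> \<one> (Unit V) = g \<otimes> \<one> (Unit V)" "f \<in> Ar V" "g \<in> Ar V" "Dom V f = Dom V g" "Cod V f = Cod V g"
  shows "f = g"
proof (rule iso_cancel_right)
  show "f \<cdot> RU V (Dom V f) = g \<cdot> RU V (Dom V f)"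
    using assms RU_nat by metis
qed (use assms in auto)

text \<open>Kelly's argument: after tensoring with the unit on the left, the pentagon for
  \<open>I, I, x, y\<close> applies, the triangle trades \<open>1 \<otimes> LU\<close> for
  \<open>RU \<otimes> 1\<close>, and naturality of \<open>Assoc\<close> closes the diagram.\<close>

lemma LU_TensO:
  assumes [simp]: "x \<in> Ob V" "y \<in> Ob V"
  shows "LU V (x \<otimes>\<^sub>o y) \<cdot> Assoc V (Unit V) x y = LU V x \<otimes> \<one> y"
proof (rule Unit_TensA_cancel, rule iso_cancel_right)
  let ?I = "Unit V"
  \<comment> \<open>The first two arrows on the longer side of the pentagon; precomposing with this
    isomorphism makes the pentagon applicable.\<close>
  let ?m = "Assoc V ?I (?I \<otimes>\<^sub>o x) y \<cdot> (Assoc V ?I ?I x \<otimes> \<one> y)"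
  have "(\<one> ?I \<otimes> (LU V (x \<otimes>\<^sub>o y) \<cdot> Assoc V ?I x y)) \<cdot> ?m =
      (\<one> ?I \<otimes> LU V (x \<otimes>\<^sub>o y)) \<cdot> (\<one> ?I \<otimes> Assoc V ?I x y) \<cdot> ?m"
    by simp
  also have "\<dots> = (\<one> ?I \<otimes> LU V (x \<otimes>\<^sub>o y)) \<cdot> Assoc V ?I ?I (x \<otimes>\<^sub>o y) \<cdot> Assoc V (?I \<otimes>\<^sub>o ?I) x y"
    by (subst pentagon) auto
  also have "\<dots> = ((\<one> ?I \<otimes> LU V (x \<otimes>\<^sub>o y)) \<cdot> Assoc V ?I ?I (x \<otimes>\<^sub>o y)) \<cdot> Assoc V (?I \<otimes>\<^sub>o ?I) x y"
    by simp
  also have "\<dots> = (RU V ?I \<otimes> \<one> x \<otimes> \<one> y) \<cdot> Assoc V (?I \<otimes>\<^sub>o ?I) x y"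
    by (subst triangle) auto
  also have "\<dots> = Assoc V ?I x y \<cdot> ((RU V ?I \<otimes> \<one> x) \<otimes> \<one> y)"
    using Assoc_nat[of "RU V ?I" "\<one> x" "\<one> y"] by simp
  also have "\<dots> = Assoc V ?I x y \<cdot> ((\<one> ?I \<otimes> LU V x) \<otimes> \<one> y) \<cdot> (Assoc V ?I ?I x \<otimes> \<one> y)"
    by (simp add: triangle)
  \<comment> \<open>Naturality of \<open>Assoc\<close> has to be applied as a square, before
    interchange fuses the tensors.\<close>
  also have "\<dots> = (\<one> ?I \<otimes> LU V x \<otimes> \<one> y) \<cdot> ?m"
    using Comp_square[OF Assoc_nat[of "\<one> ?I" "LU V x" "\<one> y"], of "Assoc V ?I ?I x \<otimes> \<one> y"]
    by (simp del: interchange interchange')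
  finally show "(\<one> ?I \<otimes> (LU V (x \<otimes>\<^sub>o y) \<cdot> Assoc V ?I x y)) \<cdot> ?m = (\<one> ?I \<otimes> LU V x \<otimes> \<one> y) \<cdot> ?m" .
qed auto

text \<open>The mirror image of \<open>LU_TensO\<close>: the unit is tensored on the right, the
  pentagon is the one for \<open>x, y, I, I\<close>, and the isomorphism to cancel is
  postcomposed.\<close>

lemma RU_TensO:
  assumes [simp]: "x \<in> Ob V" "y \<in> Ob V"
  shows "(\<one> x \<otimes> RU V y) \<cdot> Assoc V x y (Unit V) = RU V (x \<otimes>\<^sub>o y)"
proof (rule TensA_Unit_cancel, rule iso_cancel_left)
  let ?I = "Unit V"
  have "Assoc V x y ?I \<cdot> (((\<one> x \<otimes> RU V y) \<cdot> Assoc V x y ?I) \<otimes> \<one> ?I) =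
      Assoc V x y ?I \<cdot> ((\<one> x \<otimes> RU V y) \<otimes> \<one> ?I) \<cdot> (Assoc V x y ?I \<otimes> \<one> ?I)"
    by simp
  also have "\<dots> = (\<one> x \<otimes> RU V y \<otimes> \<one> ?I) \<cdot> Assoc V x (y \<otimes>\<^sub>o ?I) ?I \<cdot> (Assoc V x y ?I \<otimes> \<one> ?I)"
    using Comp_square[OF Assoc_nat[of "\<one> x" "RU V y" "\<one> ?I"], of "Assoc V x y ?I \<otimes> \<one> ?I"]
    by (simp del: interchange interchange')
  also have "\<dots> = (\<one> x \<otimes> \<one> y \<otimes> LU V ?I) \<cdot> (\<one> x \<otimes> Assoc V y ?I ?I) \<cdot>
      Assoc V x (y \<otimes>\<^sub>o ?I) ?I \<cdot> (Assoc V x y ?I \<otimes> \<one> ?I)"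
    by (simp add: triangle)
  also have "\<dots> = (\<one> x \<otimes> \<one> y \<otimes> LU V ?I) \<cdot> Assoc V x y (?I \<otimes>\<^sub>o ?I) \<cdot> Assoc V (x \<otimes>\<^sub>o y) ?I ?I"
    by (subst pentagon) auto
  also have "\<dots> = Assoc V x y ?I \<cdot> ((\<one> x \<otimes> \<one> y) \<otimes> LU V ?I) \<cdot> Assoc V (x \<otimes>\<^sub>o y) ?I ?I"
    using Comp_square[OF Assoc_nat[of "\<one> x" "\<one> y" "LU V ?I"], of "Assoc V (x \<otimes>\<^sub>o y) ?I ?I"]
    by (simp del: interchange interchange')
  also have "\<dots> = Assoc V x y ?I \<cdot> (RU V (x \<otimes>\<^sub>o y) \<otimes> \<one> ?I)"
    by (simp add: triangle)
  finally show "Assoc V x y ?I \<cdot> (((\<one> x \<otimes> RU V y) \<cdot> Assoc V x y ?I) \<otimes> \<one> ?I) =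
    Assoc V x y ?I \<cdot> (RU V (x \<otimes>\<^sub>o y) \<otimes> \<one> ?I)" .
qed auto

text \<open>Naturality of \<open>LU\<close> along \<open>LU I\<close> gives
  \<open>LU (I \<otimes> I) = 1 \<otimes> LU I\<close>. Composed with the associator, the left side
  is \<open>LU I \<otimes> 1\<close> by \<open>LU_TensO\<close> and the right side is
  \<open>RU I \<otimes> 1\<close> by the triangle.\<close>

lemma LU_Unit: "LU V (Unit V) = RU V (Unit V)"
proof (rule TensA_Unit_cancel)
  let ?I = "Unit V"
  have "LU V (?I \<otimes>\<^sub>o ?I) = \<one> ?I \<otimes> LU V ?I"
    by (rule iso_cancel_left[of "LU V ?I"]) (use LU_nat[of "LU V ?I"] in auto)
  then show "LU V ?I \<otimes> \<one> ?I = RU V ?I \<otimes> \<one> ?I"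
    using LU_TensO[of ?I ?I] triangle[of ?I ?I] by simp
qed auto

text \<open>
  Put \<open>d = \<rho> c \<lambda>\<^sup>-\<^sup>1\<close>. Naturality of the braiding along \<open>I \<otimes> I \<rightarrow> I\<close> and the second hexagon give
  \<open>c = (d \<otimes> 1) c\<close>, so \<open>d = 1\<close>.
\<close>

lemma RU_Braid_Unit:
  assumes [simp]: "a \<in> Ob V"
  shows "RU V a \<cdot> Braid V (Unit V) a = LU V a"
proof -
  let ?I = "Unit V"
  let ?c = "Braid V ?I a"
  define d where "d = RU V a \<cdot> ?c \<cdot> Inv V (LU V a)"
  have d [simp]: "d \<in> Ar V" "Dom V d = a" "Cod V d = a" by (auto simp: d_def)
  have dLU: "d \<cdot> LU V a = RU V a \<cdot> ?c" by (simp add: d_def)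
  have hex: "Braid V (?I \<otimes>\<^sub>o ?I) a = Assoc V a ?I ?I \<cdot>
     (?c \<otimes> \<one> ?I) \<cdot> Inv V (Assoc V ?I a ?I) \<cdot> (\<one> ?I \<otimes> ?c) \<cdot> Assoc V ?I ?I a" (is "?b = _")
  proof -
    have "Assoc V a ?I ?I \<cdot> (Inv V (Assoc V a ?I ?I) \<cdot> ?b \<cdot> Inv V (Assoc V ?I ?I a)) \<cdot> Assoc V ?I ?I a = ?b"
      by simp
    then show ?thesis unfolding hexagon2[OF Unit_Ob Unit_Ob assms] by simp
  qed
  have LU: "(LU V a \<otimes> \<one> ?I) \<cdot> Inv V (Assoc V ?I a ?I) = LU V (a \<otimes>\<^sub>o ?I)"
    by (simp flip: LU_TensO)
  have "?c \<cdot> (LU V ?I \<otimes> \<one> a) = (\<one> a \<otimes> LU V ?I) \<cdot> ?b"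
    using Braid_nat[of "LU V ?I" "\<one> a"] by simp
  also have "\<dots> = ((\<one> a \<otimes> LU V ?I) \<cdot> Assoc V a ?I ?I) \<cdot>
      (?c \<otimes> \<one> ?I) \<cdot> Inv V (Assoc V ?I a ?I) \<cdot> (\<one> ?I \<otimes> ?c) \<cdot> Assoc V ?I ?I a"
    unfolding hex by simp
  also have "\<dots> = ((d \<cdot> LU V a) \<otimes> \<one> ?I) \<cdot> Inv V (Assoc V ?I a ?I) \<cdot> (\<one> ?I \<otimes> ?c) \<cdot> Assoc V ?I ?I a"
    unfolding triangle[OF assms Unit_Ob] dLU by simp
  also have "\<dots> = (d \<otimes> \<one> ?I) \<cdot> ((LU V a \<otimes> \<one> ?I) \<cdot> Inv V (Assoc V ?I a ?I)) \<cdot> (\<one> ?I \<otimes> ?c) \<cdot> Assoc V ?I ?I a"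
    by simp
  also have "\<dots> = (d \<otimes> \<one> ?I) \<cdot> (LU V (a \<otimes>\<^sub>o ?I) \<cdot> (\<one> ?I \<otimes> ?c)) \<cdot> Assoc V ?I ?I a"
    unfolding LU by simp
  also have "\<dots> = (d \<otimes> \<one> ?I) \<cdot> ?c \<cdot> LU V (?I \<otimes>\<^sub>o a) \<cdot> Assoc V ?I ?I a"
    using LU_nat[of ?c] by simp
  also have "\<dots> = ((d \<otimes> \<one> ?I) \<cdot> ?c) \<cdot> (LU V ?I \<otimes> \<one> a)"
    unfolding LU_TensO[OF Unit_Ob assms] by simp
  finally have "?c = (d \<otimes> \<one> ?I) \<cdot> ?c"
    by (rule iso_cancel_right) auto
  then have "\<one> (a \<otimes>\<^sub>o ?I) \<cdot> ?c = (d \<otimes> \<one> ?I) \<cdot> ?c" by simp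
  then have "\<one> (a \<otimes>\<^sub>o ?I) = d \<otimes> \<one> ?I"
    by (rule iso_cancel_right) auto
  then have "\<one> a \<otimes> \<one> ?I = d \<otimes> \<one> ?I" by simp
  then have "\<one> a = d" by (rule TensA_Unit_cancel) auto
  then show ?thesis using dLU by (simp flip: \<open>\<one> a = d\<close>)
qed

end

section \<open>The strictification\<close>

context braided_monoidal_category
begin

lemma tens_list_Ob [simp]: "set xs \<subseteq> Ob V \<Longrightarrow> tens_list V xs \<in> Ob V"
  by (induction xs rule: induct_list012) auto

lemma merge_simps [simp]:
  assumes "set xs \<subseteq> Ob V" "set ys \<subseteq> Ob V"
  shows "merge V xs ys \<in> Ar V" "Dom V (merge V xs ys) = tens_list V xs \<otimes>\<^sub>o tens_list V ys"
    "Cod V (merge V xs ys) = tens_list V (xs @ ys)" "is_iso V (merge V xs ys)"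
proof -
  have "merge V xs ys \<in> Ar V \<and> Dom V (merge V xs ys) = tens_list V xs \<otimes>\<^sub>o tens_list V ys \<and>
    Cod V (merge V xs ys) = tens_list V (xs @ ys) \<and> is_iso V (merge V xs ys)"
    using assms
  proof (induction xs rule: induct_list012)
    case (2 x)
    then show ?case by (cases ys) auto
  qed auto
  then show "merge V xs ys \<in> Ar V" "Dom V (merge V xs ys) = tens_list V xs \<otimes>\<^sub>o tens_list V ys"
    "Cod V (merge V xs ys) = tens_list V (xs @ ys)" "is_iso V (merge V xs ys)"
    by auto
qed

text \<open>The recursion of \<open>merge\<close> is on its left list, so the right unit law needs
  proof: the empty list requires \<open>LU\<close> and \<open>RU\<close> to agree at the unit,
  longer lists require \<open>RU_TensO\<close>.\<close>

lemma merge_Nil_right: "set xs \<subseteq> Ob V \<Longrightarrow> merge V xs [] = RU V (tens_list V xs)"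
  by (induction xs rule: induct_list012) (auto simp: LU_Unit RU_TensO)

text \<open>Each case of the induction on \<open>xs\<close> consumes one coherence law:
  \<open>LU_TensO\<close> with naturality of \<open>LU\<close> for the empty list, the triangle for
  a singleton with \<open>ys\<close> empty (for other \<open>ys\<close> both sides agree by
  definition), the pentagon for longer lists.\<close>

lemma merge_assoc:
  assumes "set xs \<subseteq> Ob V" "set ys \<subseteq> Ob V" "set zs \<subseteq> Ob V"
  shows "merge V (xs @ ys) zs \<cdot> (merge V xs ys \<otimes> \<one> (tens_list V zs)) =
    merge V xs (ys @ zs) \<cdot> (\<one> (tens_list V xs) \<otimes> merge V ys zs) \<cdot>
      Assoc V (tens_list V xs) (tens_list V ys) (tens_list V zs)"
  using assms
proof (induction xs rule: induct_list012)
  case 1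
  let ?y = "tens_list V ys" and ?z = "tens_list V zs"
  have "merge V ys zs \<cdot> (LU V ?y \<otimes> \<one> ?z) =
      (merge V ys zs \<cdot> LU V (?y \<otimes>\<^sub>o ?z)) \<cdot> Assoc V (Unit V) ?y ?z"
    using 1 by (simp add: LU_TensO)
  also have "\<dots> = (LU V (tens_list V (ys @ zs)) \<cdot> (\<one> (Unit V) \<otimes> merge V ys zs)) \<cdot> Assoc V (Unit V) ?y ?z"
    using 1 LU_nat[of "merge V ys zs"] by simp
  finally show ?case using 1 by simp
next
  case (2 x)
  show ?case
  proof (cases ys)
    case Nil
    then show ?thesis using 2 triangle[of x "tens_list V zs"] by simp
  next
    case (Cons y ys')
    then show ?thesis using 2 by simp
  qed
next
  case (3 x x' xs')
  let ?xs = "x' # xs'"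
  let ?x = "tens_list V ?xs" and ?y = "tens_list V ys" and ?z = "tens_list V zs"
  have Ob: "x \<in> Ob V" "set ?xs \<subseteq> Ob V" "set ys \<subseteq> Ob V" "set zs \<subseteq> Ob V"
    and [simp]: "?x \<in> Ob V" "?y \<in> Ob V" "?z \<in> Ob V" "x \<in> Ob V"
    using "3.prems" by auto
  let ?mxy = "merge V ?xs ys" and ?myz = "merge V ys zs"
  note m [simp] = merge_simps[OF Ob(2,3)] merge_simps[OF Ob(3,4)]
    merge_simps[of "?xs @ ys" zs] merge_simps[of ?xs "ys @ zs"]
  have IH: "merge V (?xs @ ys) zs \<cdot> (?mxy \<otimes> \<one> ?z) =
      merge V ?xs (ys @ zs) \<cdot> (\<one> ?x \<otimes> ?myz) \<cdot> Assoc V ?x ?y ?z"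
    using 3 by simp
  have u: "set (?xs @ ys) \<subseteq> Ob V" "set (ys @ zs) \<subseteq> Ob V" using Ob by auto
  have "merge V ((x # ?xs) @ ys) zs \<cdot> (merge V (x # ?xs) ys \<otimes> \<one> ?z) =
      (\<one> x \<otimes> merge V (?xs @ ys) zs) \<cdot> Assoc V x (tens_list V (?xs @ ys)) ?z \<cdot>
        ((\<one> x \<otimes> ?mxy) \<otimes> \<one> ?z) \<cdot> (Assoc V x ?x ?y \<otimes> \<one> ?z)"
    using Ob u by (simp del: tens_list.simps)
  also have "\<dots> = (\<one> x \<otimes> merge V (?xs @ ys) zs) \<cdot> (\<one> x \<otimes> ?mxy \<otimes> \<one> ?z) \<cdot>
      Assoc V x (?x \<otimes>\<^sub>o ?y) ?z \<cdot> (Assoc V x ?x ?y \<otimes> \<one> ?z)"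
    using Ob u Comp_square[OF Assoc_nat[of "\<one> x" ?mxy "\<one> ?z"], of "Assoc V x ?x ?y \<otimes> \<one> ?z"]
    by (simp del: tens_list.simps merge.simps interchange interchange')
  also have "\<dots> = (\<one> x \<otimes> merge V ?xs (ys @ zs)) \<cdot> (\<one> x \<otimes> \<one> ?x \<otimes> ?myz) \<cdot> (\<one> x \<otimes> Assoc V ?x ?y ?z) \<cdot>
      Assoc V x (?x \<otimes>\<^sub>o ?y) ?z \<cdot> (Assoc V x ?x ?y \<otimes> \<one> ?z)"
    using Ob u IH by (simp del: tens_list.simps merge.simps append_Cons)
  also have "\<dots> = (\<one> x \<otimes> merge V ?xs (ys @ zs)) \<cdot> (\<one> x \<otimes> \<one> ?x \<otimes> ?myz) \<cdot>
      Assoc V x ?x (?y \<otimes>\<^sub>o ?z) \<cdot> Assoc V (x \<otimes>\<^sub>o ?x) ?y ?z"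
    by (subst pentagon) auto
  also have "\<dots> = (\<one> x \<otimes> merge V ?xs (ys @ zs)) \<cdot> Assoc V x ?x (tens_list V (ys @ zs)) \<cdot>
      ((\<one> x \<otimes> \<one> ?x) \<otimes> ?myz) \<cdot> Assoc V (x \<otimes>\<^sub>o ?x) ?y ?z"
    using Ob u Comp_square[OF Assoc_nat[of "\<one> x" "\<one> ?x" ?myz], of "Assoc V (x \<otimes>\<^sub>o ?x) ?y ?z"]
    by (simp del: tens_list.simps merge.simps interchange interchange')
  also have "\<dots> = merge V (x # ?xs) (ys @ zs) \<cdot> (\<one> (tens_list V (x # ?xs)) \<otimes> ?myz) \<cdot>
      Assoc V (tens_list V (x # ?xs)) ?y ?z"
    using Ob u by simp
  finally show ?case .
qed

text \<open>Associativity of the tensor product of arrows in the strictification.\<close>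

lemma merged_TensA_assoc:
  assumes Ob: "set xs \<subseteq> Ob V" "set ys \<subseteq> Ob V" "set zs \<subseteq> Ob V"
      "set xs' \<subseteq> Ob V" "set ys' \<subseteq> Ob V" "set zs' \<subseteq> Ob V"
    and f: "f \<in> Ar V" "Dom V f = tens_list V xs" "Cod V f = tens_list V xs'"
    and g: "g \<in> Ar V" "Dom V g = tens_list V ys" "Cod V g = tens_list V ys'"
    and h: "h \<in> Ar V" "Dom V h = tens_list V zs" "Cod V h = tens_list V zs'"
  shows "merge V (xs' @ ys') zs' \<cdot> ((merge V xs' ys' \<cdot> (f \<otimes> g) \<cdot> Inv V (merge V xs ys)) \<otimes> h) \<cdot>
      Inv V (merge V (xs @ ys) zs) =
    merge V xs' (ys' @ zs') \<cdot> (f \<otimes> (merge V ys' zs' \<cdot> (g \<otimes> h) \<cdot> Inv V (merge V ys zs))) \<cdot>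
      Inv V (merge V xs (ys @ zs))" (is "?X = ?Y")
proof (rule iso_cancel_right)
  let ?x = "tens_list V xs" and ?y = "tens_list V ys" and ?z = "tens_list V zs"
  let ?x' = "tens_list V xs'" and ?y' = "tens_list V ys'" and ?z' = "tens_list V zs'"
  \<comment> \<open>Precomposing with \<open>?L\<close> cancels the inverse merges of the left-hand
    side. Then \<open>merge_assoc\<close> exchanges \<open>?L'\<close> for the other flattening,
    past which naturality of \<open>Assoc\<close> can be used.\<close>
  let ?L = "merge V (xs @ ys) zs \<cdot> (merge V xs ys \<otimes> \<one> ?z)"
  let ?L' = "merge V (xs' @ ys') zs' \<cdot> (merge V xs' ys' \<otimes> \<one> ?z')"
  let ?R' = "merge V xs' (ys' @ zs') \<cdot> (\<one> ?x' \<otimes> merge V ys' zs')"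
  have "?X \<cdot> ?L = ?L' \<cdot> ((f \<otimes> g) \<otimes> h)" using Ob f g h by simp
  also have "\<dots> = ?R' \<cdot> Assoc V ?x' ?y' ?z' \<cdot> ((f \<otimes> g) \<otimes> h)"
    unfolding merge_assoc[OF Ob(4-6)] using Ob f g h by simp
  also have "\<dots> = ?R' \<cdot> (f \<otimes> g \<otimes> h) \<cdot> Assoc V ?x ?y ?z"
    using Assoc_nat[of f g h] Ob f g h by simp
  also have "\<dots> = ?Y \<cdot> merge V xs (ys @ zs) \<cdot> (\<one> ?x \<otimes> merge V ys zs) \<cdot> Assoc V ?x ?y ?z"
    using Ob f g h by simp
  also have "\<dots> = ?Y \<cdot> ?L"
    unfolding merge_assoc[OF Ob(1-3)] ..
  finally show "?X \<cdot> ?L = ?Y \<cdot> ?L" .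
qed (use assms in auto)

end


text \<open>Isolates what the later sections use of \<open>strictify V\<close>, so that they compute
  with abstract arrows instead of triples conjugated by \<open>merge\<close>. Since the monoid laws
  are equalities of objects, equations between arrows can be stated without constraints.\<close>

locale strict_base = tensor_data S + category S
  for S :: "('o, 'a, 'm) tensor_cat_scheme" (structure) +
  assumes Unit_Ob: "Unit S \<in> Ob S"
    and TensO_Ob: "x \<in> Ob S \<Longrightarrow> y \<in> Ob S \<Longrightarrow> x \<otimes>\<^sub>o y \<in> Ob S"
    and TensO_assoc: "x \<in> Ob S \<Longrightarrow> y \<in> Ob S \<Longrightarrow> z \<in> Ob S \<Longrightarrow> (x \<otimes>\<^sub>o y) \<otimes>\<^sub>o z = x \<otimes>\<^sub>o y \<otimes>\<^sub>o z"
    and TensO_Unit_left: "x \<in> Ob S \<Longrightarrow> Unit S \<otimes>\<^sub>o x = x"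
    and TensO_Unit_right: "x \<in> Ob S \<Longrightarrow> x \<otimes>\<^sub>o Unit S = x"
    and TensA_Hom: "f \<in> Hom S x x' \<Longrightarrow> g \<in> Hom S y y' \<Longrightarrow> f \<otimes> g \<in> Hom S (x \<otimes>\<^sub>o y) (x' \<otimes>\<^sub>o y')"
    and TensA_Id: "x \<in> Ob S \<Longrightarrow> y \<in> Ob S \<Longrightarrow> \<one> x \<otimes> \<one> y = \<one> (x \<otimes>\<^sub>o y)"
    and TensA_Comp: "f \<in> Hom S x x' \<Longrightarrow> f' \<in> Hom S x' x'' \<Longrightarrow> g \<in> Hom S y y' \<Longrightarrow> g' \<in> Hom S y' y'' \<Longrightarrow>
      (f' \<cdot> f) \<otimes> (g' \<cdot> g) = (f' \<otimes> g') \<cdot> (f \<otimes> g)"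
    and TensA_assoc: "f \<in> Ar S \<Longrightarrow> g \<in> Ar S \<Longrightarrow> h \<in> Ar S \<Longrightarrow> (f \<otimes> g) \<otimes> h = f \<otimes> g \<otimes> h"
    and TensA_Unit_left: "f \<in> Ar S \<Longrightarrow> \<one> (Unit S) \<otimes> f = f"
    and TensA_Unit_right: "f \<in> Ar S \<Longrightarrow> f \<otimes> \<one> (Unit S) = f"
    and Braid_Hom: "x \<in> Ob S \<Longrightarrow> y \<in> Ob S \<Longrightarrow>
      Braid S x y \<in> Hom S (x \<otimes>\<^sub>o y) (y \<otimes>\<^sub>o x) \<and> is_iso S (Braid S x y)"
    and Braid_natural: "f \<in> Hom S x x' \<Longrightarrow> g \<in> Hom S y y' \<Longrightarrow>
      Braid S x' y' \<cdot> (f \<otimes> g) = (g \<otimes> f) \<cdot> Braid S x y"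
    and Braid_Unit: "x \<in> Ob S \<Longrightarrow> Braid S (Unit S) x = \<one> x"
    and coreflexive_equalizers: "coreflexive_pair S f g \<Longrightarrow> \<exists>e. is_equalizer S f g e"

section \<open>Verification of the axioms of \<open>strict_base\<close> for the
  strictification\<close>

lemma strictify_simps [simp]:
  "Ob (strictify V) = {xs. set xs \<subseteq> Ob V}"
  "(xs, f, ys) \<in> Ar (strictify V) \<longleftrightarrow>
    set xs \<subseteq> Ob V \<and> set ys \<subseteq> Ob V \<and> f \<in> Hom V (tens_list V xs) (tens_list V ys)"
  "Dom (strictify V) (xs, f, ys) = xs"
  "Cod (strictify V) (xs, f, ys) = ys"
  "Id (strictify V) xs = (xs, \<one>\<^bsub>V\<^esub> (tens_list V xs), xs)"
  "(ys', g, zs) \<cdot>\<^bsub>strictify V\<^esub> (xs, f, ys) = (xs, g \<cdot>\<^bsub>V\<^esub> f, zs)"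
  "Unit (strictify V) = []"
  "xs \<otimes>\<^sub>o\<^bsub>strictify V\<^esub> ys = xs @ ys"
  "(xs, f, ys) \<otimes>\<^bsub>strictify V\<^esub> (xs', f', ys') =
    (xs @ xs', merge V ys ys' \<cdot>\<^bsub>V\<^esub> (f \<otimes>\<^bsub>V\<^esub> f') \<cdot>\<^bsub>V\<^esub> Inv V (merge V xs xs'), ys @ ys')"
  "Braid (strictify V) xs ys =
    (xs @ ys, merge V ys xs \<cdot>\<^bsub>V\<^esub> Braid V (tens_list V xs) (tens_list V ys) \<cdot>\<^bsub>V\<^esub> Inv V (merge V xs ys), ys @ xs)"
  by (auto simp: strictify_def)

lemma strictify_Ar_iff: "u \<in> Ar (strictify V) \<longleftrightarrow> (\<exists>xs f ys. u = (xs, f, ys) \<and>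
    set xs \<subseteq> Ob V \<and> set ys \<subseteq> Ob V \<and> f \<in> Hom V (tens_list V xs) (tens_list V ys))"
  by (cases u) auto

context braided_monoidal_category
begin

lemma category_strictify: "category (strictify V)"
  by (unfold_locales) (auto simp: Hom_def strictify_Ar_iff)

lemma is_iso_strictify:
  assumes "is_iso V f" "set xs \<subseteq> Ob V" "set ys \<subseteq> Ob V" "Dom V f = tens_list V xs" "Cod V f = tens_list V ys"
  shows "is_iso (strictify V) (xs, f, ys)"
proof (rule category.is_isoI[OF category_strictify])
  show "(ys, Inv V f, xs) \<in> Ar (strictify V)" using assms by (auto simp: Hom_iff)
qed (use assms in \<open>auto simp: Hom_iff is_iso_Ar\<close>)

end

context quantum_base
begin

text \<open>Arrows between lists are arrows of \<open>V\<close> between their tensor products, so a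
  coreflexive pair of the strictification, with its retraction, is one of \<open>V\<close>.\<close>

lemma strictify_equalizer:
  assumes "coreflexive_pair (strictify V) u v"
  shows "\<exists>e. is_equalizer (strictify V) u v e"
proof -
  obtain xs ys f g r where uv: "u = (xs, f, ys)" "v = (xs, g, ys)"
    and Ob: "set xs \<subseteq> Ob V" "set ys \<subseteq> Ob V"
    and fg: "f \<in> Hom V (tens_list V xs) (tens_list V ys)" "g \<in> Hom V (tens_list V xs) (tens_list V ys)"
    and r: "r \<in> Hom V (tens_list V ys) (tens_list V xs)" "r \<cdot> f = \<one> (tens_list V xs)" "r \<cdot> g = \<one> (tens_list V xs)"
    using assms by (auto simp: coreflexive_pair_def parallel_def strictify_Ar_iff Hom_def)
  have "coreflexive_pair V f g"
    using fg r by (auto simp: coreflexive_pair_def parallel_def Hom_iff)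
  then obtain e where e: "is_equalizer V f g e" using coreflexive_equalizers by blast
  then have e': "e \<in> Ar V" "Cod V e = tens_list V xs" "f \<cdot> e = g \<cdot> e"
    using fg by (auto simp: is_equalizer_def Hom_iff)
  \<comment> \<open>The equalizing object of \<open>V\<close> is represented by a one-letter list,
    whose tensor product is that object itself.\<close>
  have "is_equalizer (strictify V) u v ([Dom V e], e, xs)"
    unfolding is_equalizer_def
  proof (intro conjI ballI impI)
    fix h assume h: "h \<in> Ar (strictify V)"
      "Cod (strictify V) h = Dom (strictify V) u \<and> u \<cdot>\<^bsub>strictify V\<^esub> h = v \<cdot>\<^bsub>strictify V\<^esub> h"
    then obtain ws k where k: "h = (ws, k, xs)" "set ws \<subseteq> Ob V" "k \<in> Hom V (tens_list V ws) (tens_list V xs)"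
      "f \<cdot> k = g \<cdot> k"
      by (auto simp: strictify_Ar_iff uv)
    then have kA: "k \<in> Ar V" and "Cod V k = Dom V f \<and> f \<cdot> k = g \<cdot> k" using fg by (simp_all add: Hom_iff)
    then have "\<exists>!w. w \<in> Hom V (Dom V k) (Dom V e) \<and> e \<cdot> w = k"
      using e unfolding is_equalizer_def by blast
    then obtain w where w: "w \<in> Hom V (Dom V k) (Dom V e)" "e \<cdot> w = k"
      and uniq: "\<And>w'. w' \<in> Hom V (Dom V k) (Dom V e) \<Longrightarrow> e \<cdot> w' = k \<Longrightarrow> w' = w" by blast
    show "\<exists>!w. w \<in> Hom (strictify V) (Dom (strictify V) h) (Dom (strictify V) ([Dom V e], e, xs)) \<and>
        ([Dom V e], e, xs) \<cdot>\<^bsub>strictify V\<^esub> w = h"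
    proof (rule ex1I[of _ "(ws, w, [Dom V e])"])
      fix v assume "v \<in> Hom (strictify V) (Dom (strictify V) h) (Dom (strictify V) ([Dom V e], e, xs)) \<and>
        ([Dom V e], e, xs) \<cdot>\<^bsub>strictify V\<^esub> v = h"
      then obtain w' where "v = (ws, w', [Dom V e])" "w' \<in> Hom V (tens_list V ws) (Dom V e)" "e \<cdot> w' = k"
        using k by (auto simp: Hom_def strictify_Ar_iff)
      then show "v = (ws, w, [Dom V e])" using uniq k by (simp add: Hom_iff)
    next
      show "(ws, w, [Dom V e]) \<in> Hom (strictify V) (Dom (strictify V) h) (Dom (strictify V) ([Dom V e], e, xs)) \<and>
          ([Dom V e], e, xs) \<cdot>\<^bsub>strictify V\<^esub> (ws, w, [Dom V e]) = h"
        using k w e'(1) by (simp add: category.Hom_iff[OF category_strictify] Hom_iff)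
    qed
  qed (use uv Ob fg e' in \<open>auto simp: parallel_def Hom_iff\<close>)
  then show ?thesis by blast
qed

text \<open>Conjugation by \<open>merge\<close> turns each law into a coherence fact: associativity
  into \<open>merged_TensA_assoc\<close>, the unit laws into naturality of \<open>LU\<close> and
  \<open>RU\<close>, triviality of the braiding at the unit into
  \<open>RU_Braid_Unit\<close>.\<close>

lemma strict_base_strictify: "strict_base (strictify V)"
proof -
  interpret S: category "strictify V" by (rule category_strictify)
  show ?thesis
  proof
    show "f \<otimes>\<^bsub>strictify V\<^esub> g \<in> Hom (strictify V) (x \<otimes>\<^sub>o\<^bsub>strictify V\<^esub> y) (x' \<otimes>\<^sub>o\<^bsub>strictify V\<^esub> y')"
      if "f \<in> Hom (strictify V) x x'" "g \<in> Hom (strictify V) y y'" for f g x x' y y'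
      using that by (auto simp: strictify_Ar_iff Hom_iff S.Hom_iff)
    show "(f' \<cdot>\<^bsub>strictify V\<^esub> f) \<otimes>\<^bsub>strictify V\<^esub> (g' \<cdot>\<^bsub>strictify V\<^esub> g) =
        (f' \<otimes>\<^bsub>strictify V\<^esub> g') \<cdot>\<^bsub>strictify V\<^esub> (f \<otimes>\<^bsub>strictify V\<^esub> g)"
      if "f \<in> Hom (strictify V) x x'" "f' \<in> Hom (strictify V) x' x''"
        "g \<in> Hom (strictify V) y y'" "g' \<in> Hom (strictify V) y' y''" for f f' g g' x x' x'' y y' y''
      using that by (auto simp: strictify_Ar_iff Hom_iff S.Hom_iff)
    show "(f \<otimes>\<^bsub>strictify V\<^esub> g) \<otimes>\<^bsub>strictify V\<^esub> h = f \<otimes>\<^bsub>strictify V\<^esub> g \<otimes>\<^bsub>strictify V\<^esub> h"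
      if "f \<in> Ar (strictify V)" "g \<in> Ar (strictify V)" "h \<in> Ar (strictify V)" for f g h
      using that merged_TensA_assoc by (auto simp: strictify_Ar_iff Hom_iff)
    show "\<one>\<^bsub>strictify V\<^esub> (Unit (strictify V)) \<otimes>\<^bsub>strictify V\<^esub> f = f" if "f \<in> Ar (strictify V)" for f
    proof -
      obtain xs g ys where f: "f = (xs, g, ys)" "set xs \<subseteq> Ob V" "set ys \<subseteq> Ob V"
        "g \<in> Hom V (tens_list V xs) (tens_list V ys)" using \<open>f \<in> Ar (strictify V)\<close> by (auto simp: strictify_Ar_iff)
      have "LU V (tens_list V ys) \<cdot> (\<one> (Unit V) \<otimes> g) = g \<cdot> LU V (tens_list V xs)"
        using f by (intro LU_natural)
      then have "(LU V (tens_list V ys) \<cdot> (\<one> (Unit V) \<otimes> g)) \<cdot> Inv V (LU V (tens_list V xs)) = g"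
        using f by (simp add: Hom_iff)
      then show ?thesis using f by (simp add: Hom_iff)
    qed
    show "f \<otimes>\<^bsub>strictify V\<^esub> \<one>\<^bsub>strictify V\<^esub> (Unit (strictify V)) = f" if "f \<in> Ar (strictify V)" for f
    proof -
      obtain xs g ys where f: "f = (xs, g, ys)" "set xs \<subseteq> Ob V" "set ys \<subseteq> Ob V"
        "g \<in> Hom V (tens_list V xs) (tens_list V ys)" using \<open>f \<in> Ar (strictify V)\<close> by (auto simp: strictify_Ar_iff)
      have "RU V (tens_list V ys) \<cdot> (g \<otimes> \<one> (Unit V)) = g \<cdot> RU V (tens_list V xs)"
        using f by (intro RU_natural)
      then have "(RU V (tens_list V ys) \<cdot> (g \<otimes> \<one> (Unit V))) \<cdot> Inv V (RU V (tens_list V xs)) = g"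
        using f by (simp add: Hom_iff)
      then show ?thesis using f by (simp add: Hom_iff merge_Nil_right)
    qed
    show "Braid (strictify V) x y \<in> Hom (strictify V) (x \<otimes>\<^sub>o\<^bsub>strictify V\<^esub> y) (y \<otimes>\<^sub>o\<^bsub>strictify V\<^esub> x) \<and>
        is_iso (strictify V) (Braid (strictify V) x y)"
      if "x \<in> Ob (strictify V)" "y \<in> Ob (strictify V)" for x y
      using that by (auto simp: Hom_iff S.Hom_iff intro!: is_iso_strictify)
    show "Braid (strictify V) x' y' \<cdot>\<^bsub>strictify V\<^esub> (f \<otimes>\<^bsub>strictify V\<^esub> g) =
        (g \<otimes>\<^bsub>strictify V\<^esub> f) \<cdot>\<^bsub>strictify V\<^esub> Braid (strictify V) x y"
      if fg: "f \<in> Hom (strictify V) x x'" "g \<in> Hom (strictify V) y y'" for f g x x' y y'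
    proof -
      obtain f' g' where f: "f = (x, f', x')" "g = (y, g', y')"
        "set x \<subseteq> Ob V" "set y \<subseteq> Ob V" "set x' \<subseteq> Ob V" "set y' \<subseteq> Ob V"
        "f' \<in> Hom V (tens_list V x) (tens_list V x')" "g' \<in> Hom V (tens_list V y) (tens_list V y')"
        using fg by (auto simp: strictify_Ar_iff S.Hom_iff)
      have "(Braid V (tens_list V x') (tens_list V y') \<cdot> (f' \<otimes> g')) \<cdot> Inv V (merge V x y) =
          ((g' \<otimes> f') \<cdot> Braid V (tens_list V x) (tens_list V y)) \<cdot> Inv V (merge V x y)"
        by (simp only: Braid_natural[OF f(7,8)])
      then show ?thesis using f by (simp add: Hom_iff)
    qed
    show "Braid (strictify V) (Unit (strictify V)) x = \<one>\<^bsub>strictify V\<^esub> x" if "x \<in> Ob (strictify V)" for x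
    proof -
      let ?x = "tens_list V x"
      have "(RU V ?x \<cdot> Braid V (Unit V) ?x) \<cdot> Inv V (LU V ?x) = \<one> ?x"
        using that by (subst RU_Braid_Unit) auto
      then show ?thesis using that by (simp add: merge_Nil_right)
    qed
    show "\<exists>e. is_equalizer (strictify V) f g e" if "coreflexive_pair (strictify V) f g" for f g
      using that by (rule strictify_equalizer)
  qed auto
qed

end

section \<open>Cotensor products\<close>

context strict_base
begin

declare Unit_Ob [simp] TensO_Ob [simp] TensO_assoc [simp] TensO_Unit_left [simp] TensO_Unit_right [simp]
  TensA_Id [simp] TensA_Unit_left [simp] TensA_Unit_right [simp]

lemma TensA_Ar [simp]: "f \<in> Ar S \<Longrightarrow> g \<in> Ar S \<Longrightarrow> f \<otimes> g \<in> Ar S"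
  and Dom_TensA [simp]: "f \<in> Ar S \<Longrightarrow> g \<in> Ar S \<Longrightarrow> Dom S (f \<otimes> g) = Dom S f \<otimes>\<^sub>o Dom S g"
  and Cod_TensA [simp]: "f \<in> Ar S \<Longrightarrow> g \<in> Ar S \<Longrightarrow> Cod S (f \<otimes> g) = Cod S f \<otimes>\<^sub>o Cod S g"
  using TensA_Hom[of f "Dom S f" "Cod S f" g "Dom S g" "Cod S g"] by (auto simp: Hom_iff)

lemma interchange [simp]:
  "f \<in> Ar S \<Longrightarrow> f' \<in> Ar S \<Longrightarrow> g \<in> Ar S \<Longrightarrow> g' \<in> Ar S \<Longrightarrow> Cod S f = Dom S f' \<Longrightarrow> Cod S g = Dom S g' \<Longrightarrow>
    (f' \<otimes> g') \<cdot> (f \<otimes> g) = (f' \<cdot> f) \<otimes> (g' \<cdot> g)"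
  using TensA_Comp[of f "Dom S f" "Cod S f" f' "Cod S f'" g "Dom S g" "Cod S g" g' "Cod S g'"]
  by (auto simp: Hom_iff)

lemma interchange' [simp]:
  "f \<in> Ar S \<Longrightarrow> f' \<in> Ar S \<Longrightarrow> g \<in> Ar S \<Longrightarrow> g' \<in> Ar S \<Longrightarrow> Cod S f = Dom S f' \<Longrightarrow> Cod S g = Dom S g' \<Longrightarrow>
    z \<in> Ar S \<Longrightarrow> Cod S z = Dom S f \<otimes>\<^sub>o Dom S g \<Longrightarrow>
    (f' \<otimes> g') \<cdot> (f \<otimes> g) \<cdot> z = ((f' \<cdot> f) \<otimes> (g' \<cdot> g)) \<cdot> z"
  by (subst Comp_assoc'[symmetric]) auto

lemma Braid_simps [simp]:
  assumes "x \<in> Ob S" "y \<in> Ob S"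
  shows "Braid S x y \<in> Ar S" "Dom S (Braid S x y) = x \<otimes>\<^sub>o y" "Cod S (Braid S x y) = y \<otimes>\<^sub>o x"
    "is_iso S (Braid S x y)"
  using Braid_Hom[OF assms] by (auto simp: Hom_iff)

lemma Inv_Braid_natural:
  assumes f: "f \<in> Hom S x x'" and g: "g \<in> Hom S y y'"
  shows "Inv S (Braid S x' y') \<cdot> (g \<otimes> f) = (f \<otimes> g) \<cdot> Inv S (Braid S x y)"
proof -
  note [simp] = HomD[OF f] HomD[OF g]
  have "Braid S x' y' \<cdot> ((f \<otimes> g) \<cdot> Inv S (Braid S x y)) = ((Braid S x' y') \<cdot> (f \<otimes> g)) \<cdot> Inv S (Braid S x y)"
    by simp
  also have "\<dots> = Braid S x' y' \<cdot> Inv S (Braid S x' y') \<cdot> (g \<otimes> f)"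
    unfolding Braid_natural[OF f g] by simp
  finally show ?thesis by (rule iso_cancel_left[symmetric]) auto
qed

section \<open>Equalizers, factorizations and coreflexive pairs\<close>

lemma equalizer_simps:
  assumes "is_equalizer S f g m"
  shows "m \<in> Ar S" "Cod S m = Dom S f" "f \<cdot> m = g \<cdot> m"
  using assms by (auto simp: is_equalizer_def)

lemma equalizer_factor:
  "is_equalizer S f g m \<Longrightarrow> h \<in> Ar S \<Longrightarrow> Cod S h = Dom S f \<Longrightarrow> f \<cdot> h = g \<cdot> h \<Longrightarrow>
    \<exists>!u. u \<in> Hom S (Dom S h) (Dom S m) \<and> m \<cdot> u = h"
  unfolding is_equalizer_def by blast

text \<open>Unique factorization is what makes the definite description \<open>lift\<close> denote;
  every later use of \<open>lift\<close> passes through this lemma.\<close>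

lemma lift_equalizer:
  assumes "is_equalizer S f g m" "h \<in> Ar S" "Cod S h = Dom S f" "f \<cdot> h = g \<cdot> h"
  shows "lift m h \<in> Ar S" "Dom S (lift m h) = Dom S h" "Cod S (lift m h) = Dom S m" "m \<cdot> lift m h = h"
proof -
  from theI'[OF equalizer_factor[OF assms]] show "lift m h \<in> Ar S" "Dom S (lift m h) = Dom S h"
      "Cod S (lift m h) = Dom S m" "m \<cdot> lift m h = h"
    unfolding lift_def by (auto simp: Hom_iff)
qed

text \<open>Both \<open>u\<close> and \<open>v\<close> factor \<open>m \<cdot> u\<close> through
  \<open>m\<close>, and such a factorization is unique.\<close>

lemma equalizer_mono:
  assumes m: "is_equalizer S f g m" and uv: "u \<in> Ar S" "v \<in> Ar S" "Dom S u = Dom S v"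
    "Cod S u = Dom S m" "Cod S v = Dom S m" and eq: "m \<cdot> u = m \<cdot> v"
  shows "u = v"
proof -
  note [simp] = equalizer_simps(1,2)[OF m]
  have fg: "f \<in> Ar S" "g \<in> Ar S" "Dom S g = Dom S f" using m by (auto simp: is_equalizer_def parallel_def)
  have "(f \<cdot> m) \<cdot> u = (g \<cdot> m) \<cdot> u" by (simp only: equalizer_simps(3)[OF m])
  then have "f \<cdot> m \<cdot> u = g \<cdot> m \<cdot> u" using uv fg by simp
  then have "\<exists>!w. w \<in> Hom S (Dom S (m \<cdot> u)) (Dom S m) \<and> m \<cdot> w = m \<cdot> u"
    using uv fg by (intro equalizer_factor[OF m]) auto
  moreover have "u \<in> Hom S (Dom S (m \<cdot> u)) (Dom S m)" "v \<in> Hom S (Dom S (m \<cdot> u)) (Dom S m)"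
    using uv by auto
  ultimately show ?thesis using eq by metis
qed

text \<open>The common retraction is \<open>e\<close> applied to the middle factor: on one leg it
  cancels by the counit law of \<open>\<rho>\<close>, on the other by that of \<open>l\<close>. So
  the pair is coreflexive and the choice in \<open>eqz\<close> has a witness.\<close>

lemma eqz_cotensor:
  assumes \<rho>: "\<rho> \<in> Hom S m (m \<otimes>\<^sub>o x)" and l: "l \<in> Hom S n (x \<otimes>\<^sub>o n)" and e: "e \<in> Hom S x (Unit S)"
    and \<rho>e: "(\<one> m \<otimes> e) \<cdot> \<rho> = \<one> m" and le: "(e \<otimes> \<one> n) \<cdot> l = \<one> n"
  shows "is_equalizer S (\<rho> \<otimes> \<one> n) (\<one> m \<otimes> l) (eqz (\<rho> \<otimes> \<one> n) (\<one> m \<otimes> l))"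
proof -
  note [simp] = HomD[OF \<rho>] HomD[OF l] HomD[OF e]
  have "(\<one> m \<otimes> e \<otimes> \<one> n) \<cdot> (\<rho> \<otimes> \<one> n) = ((\<one> m \<otimes> e) \<otimes> \<one> n) \<cdot> (\<rho> \<otimes> \<one> n)"
    by (subst TensA_assoc) auto
  also have "\<dots> = \<one> (m \<otimes>\<^sub>o n)" by (simp add: \<rho>e)
  finally have "(\<one> m \<otimes> e \<otimes> \<one> n) \<cdot> (\<rho> \<otimes> \<one> n) = \<one> (m \<otimes>\<^sub>o n)" .
  moreover have "(\<one> m \<otimes> e \<otimes> \<one> n) \<cdot> (\<one> m \<otimes> l) = \<one> (m \<otimes>\<^sub>o n)" by (simp add: le)
  ultimately have "coreflexive_pair S (\<rho> \<otimes> \<one> n) (\<one> m \<otimes> l)"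
    unfolding coreflexive_pair_def parallel_def
    by (auto simp: Hom_iff intro!: bexI[of _ "\<one> m \<otimes> e \<otimes> \<one> n"])
  then show ?thesis unfolding eqz_def using coreflexive_equalizers by (metis someI_ex)
qed

section \<open>Comodules and the cotensor products of 1-cells\<close>

lemma comonoid_simps:
  assumes "comonoid K"
  shows "obj K \<in> Ob S" "comult K \<in> Ar S" "Dom S (comult K) = obj K" "Cod S (comult K) = obj K \<otimes>\<^sub>o obj K"
    "counit K \<in> Ar S" "Dom S (counit K) = obj K" "Cod S (counit K) = Unit S"
    "(counit K \<otimes> \<one> (obj K)) \<cdot> comult K = \<one> (obj K)"
    "(\<one> (obj K) \<otimes> counit K) \<cdot> comult K = \<one> (obj K)"
  using assms by (auto simp: comonoid_def Hom_iff)

lemma cell1_simps: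
  assumes "cell1 M"
  shows "bimod M \<in> Ob S" "coact M \<in> Ar S" "Dom S (coact M) = bimod M"
    "Cod S (coact M) = obj (src M) \<otimes>\<^sub>o bimod M \<otimes>\<^sub>o obj (tgt M)"
    "(counit (src M) \<otimes> \<one> (bimod M) \<otimes> counit (tgt M)) \<cdot> coact M = \<one> (bimod M)"
    "comonoid (src M)" "comonoid (tgt M)"
  using assms by (auto simp: cell1_def Hom_iff)

lemma lcoact_Hom: "cell1 M \<Longrightarrow> lcoact M \<in> Hom S (bimod M) (obj (src M) \<otimes>\<^sub>o bimod M)"
  and rcoact_Hom: "cell1 M \<Longrightarrow> rcoact M \<in> Hom S (bimod M) (bimod M \<otimes>\<^sub>o obj (tgt M))"
  by (auto simp: lcoact_def rcoact_def cell1_simps comonoid_simps)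

lemma lcoact_counit:
  assumes M: "cell1 M"
  shows "(counit (src M) \<otimes> \<one> (bimod M)) \<cdot> lcoact M = \<one> (bimod M)"
proof -
  note [simp] = cell1_simps(1-5)[OF M] comonoid_simps[OF cell1_simps(6)[OF M]] comonoid_simps[OF cell1_simps(7)[OF M]]
  \<comment> \<open>Padding with the identity of the unit supplies a third factor, so that
    interchange can combine both counits into the counit law of \<open>coact M\<close>.\<close>
  have "counit (src M) \<otimes> \<one> (bimod M) = counit (src M) \<otimes> \<one> (bimod M) \<otimes> \<one> (Unit S)" by simp
  then show ?thesis unfolding lcoact_def
    by (simp del: TensA_Unit_right TensA_Id)
qed

lemma rcoact_counit:
  assumes M: "cell1 M"
  shows "(\<one> (bimod M) \<otimes> counit (tgt M)) \<cdot> rcoact M = \<one> (bimod M)"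
proof -
  note [simp] = cell1_simps(1-5)[OF M] comonoid_simps[OF cell1_simps(6)[OF M]] comonoid_simps[OF cell1_simps(7)[OF M]]
  have "\<one> (bimod M) \<otimes> counit (tgt M) = \<one> (Unit S) \<otimes> \<one> (bimod M) \<otimes> counit (tgt M)" by simp
  then have "(\<one> (bimod M) \<otimes> counit (tgt M)) \<cdot> rcoact M =
      (\<one> (Unit S) \<otimes> \<one> (bimod M) \<otimes> counit (tgt M)) \<cdot>
      (counit (src M) \<otimes> \<one> (bimod M) \<otimes> \<one> (obj (tgt M))) \<cdot> coact M"
    unfolding rcoact_def by metis
  then show ?thesis by (simp del: TensA_Unit_left TensA_Id)
qed

lemma incl_equalizer:
  assumes "cell1 M" "cell1 N" "tgt M = src N"
  shows "is_equalizer S (rcoact M \<otimes> \<one> (bimod N)) (\<one> (bimod M) \<otimes> lcoact N) (incl M N)"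
  unfolding incl_def
  by (rule eqz_cotensor[of _ _ "obj (tgt M)" _ _ "counit (tgt M)"])
    (use assms rcoact_Hom[of M] rcoact_counit[of M] lcoact_Hom[of N] lcoact_counit[of N] in
      \<open>auto simp: cell1_simps comonoid_simps\<close>)

lemma lcoact_id1:
  assumes K: "comonoid K"
  shows "lcoact (id1 K) = comult K"
proof -
  note [simp] = comonoid_simps[OF K]
  have "lcoact (id1 K) = (\<one> (obj K \<otimes>\<^sub>o obj K) \<otimes> counit K) \<cdot> (comult K \<otimes> \<one> (obj K)) \<cdot> comult K"
    unfolding lcoact_def id1_def comult3_def using TensA_assoc[of "\<one> (obj K)" "\<one> (obj K)" "counit K"] by simp
  also have "\<dots> = (comult K \<otimes> \<one> (Unit S)) \<cdot> (\<one> (obj K) \<otimes> counit K) \<cdot> comult K"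
    by (simp del: TensA_Unit_right comonoid_simps(8,9)[OF K])
  also have "\<dots> = comult K" by simp
  finally show ?thesis .
qed

text \<open>Once \<open>lcoact (id1 K)\<close> is identified with \<open>comult K\<close>, the
  counit law of the comonoid is all that \<open>eqz_cotensor\<close> asks of the right factor;
  \<open>cell1 (id1 K)\<close> need not be established first.\<close>

lemma incl_id1_equalizer:
  assumes M: "cell1 M"
  shows "is_equalizer S (rcoact M \<otimes> \<one> (obj (tgt M))) (\<one> (bimod M) \<otimes> lcoact (id1 (tgt M)))
    (incl M (id1 (tgt M)))"
proof -
  note K = cell1_simps(7)[OF M]
  show ?thesis
    unfolding incl_def lcoact_id1[OF K]
    by (simp add: id1_def, rule eqz_cotensor[of _ _ "obj (tgt M)" _ _ "counit (tgt M)"])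
      (use M rcoact_Hom rcoact_counit in \<open>auto simp: comonoid_simps[OF K]\<close>)
qed

lemma cell2_simps:
  assumes "cell2 M N \<theta>"
  shows "\<theta> \<in> Ar S" "Dom S \<theta> = bimod M" "Cod S \<theta> = bimod N" "src N = src M" "tgt N = tgt M"
  using assms by (auto simp: cell2_def Hom_iff)

text \<open>Apply the counit to the right-hand factor of the equation making \<open>\<theta>\<close>
  a 2-cell. Intended for \<open>\<theta>\<close> the counit of a comonad.\<close>

lemma lcoact_id1_natural:
  assumes M: "cell1 M" and \<theta>: "cell2 M (id1 K) \<theta>"
  shows "lcoact (id1 K) \<cdot> \<theta> = (\<one> (obj (src M)) \<otimes> \<theta>) \<cdot> lcoact M"
proof -
  note [simp] = cell1_simps(1-5)[OF M] comonoid_simps[OF cell1_simps(6)[OF M]] comonoid_simps[OF cell1_simps(7)[OF M]]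
    cell2_simps[OF \<theta>]
  have K: "K = src M" "K = tgt M" using \<theta> by (auto simp: cell2_def id1_def)
  then have [simp]: "tgt M = src M" "obj K = obj (src M)" "counit K = counit (src M)" "comult K = comult (src M)"
    "comonoid K" using M by (auto simp: cell1_simps)
  have [simp]: "src (id1 K) = K" "tgt (id1 K) = K" "bimod (id1 K) = obj (src M)" by (auto simp: id1_def)
  have co [simp]: "coact (id1 K) \<in> Ar S" "Dom S (coact (id1 K)) = obj (src M)"
    "Cod S (coact (id1 K)) = obj (src M) \<otimes>\<^sub>o obj (src M) \<otimes>\<^sub>o obj (src M)"
    by (auto simp: id1_def comult3_def comonoid_simps)
  have "lcoact (id1 K) \<cdot> \<theta> = (\<one> (obj (src M)) \<otimes> \<one> (obj (src M)) \<otimes> counit (src M)) \<cdot> coact (id1 K) \<cdot> \<theta>"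
    by (simp add: lcoact_def)
  also have "coact (id1 K) \<cdot> \<theta> = (\<one> (obj (src M)) \<otimes> \<theta> \<otimes> \<one> (obj (src M))) \<cdot> coact M"
    using \<theta> by (simp add: cell2_def)
  also have "(\<one> (obj (src M)) \<otimes> \<one> (obj (src M)) \<otimes> counit (src M)) \<cdot> \<dots> =
      (\<one> (obj (src M)) \<otimes> \<theta> \<otimes> \<one> (Unit S)) \<cdot> (\<one> (obj (src M)) \<otimes> \<one> (bimod M) \<otimes> counit (src M)) \<cdot> coact M"
    by (simp del: TensA_Unit_right)
  finally show ?thesis by (simp add: lcoact_def del: interchange interchange')
qed

text \<open>Only the right counit law of \<open>A\<close> is needed for the equalizers defining \<open>A \<otimes>\<^sub>C A\<close> to exist.\<close>

definition right_counital :: "('o, 'a) comonoid \<Rightarrow> bool" where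
  "right_counital A \<longleftrightarrow> obj A \<in> Ob S \<and> comult A \<in> Hom S (obj A) (obj A \<otimes>\<^sub>o obj A) \<and>
     counit A \<in> Hom S (obj A) (Unit S) \<and> (\<one> (obj A) \<otimes> counit A) \<cdot> comult A = \<one> (obj A)"

section \<open>The parallel pair that defines composable pairs of arrows\<close>

lemma right_counital_simps:
  assumes "right_counital A"
  shows "obj A \<in> Ob S" "comult A \<in> Ar S" "Dom S (comult A) = obj A" "Cod S (comult A) = obj A \<otimes>\<^sub>o obj A"
    "counit A \<in> Ar S" "Dom S (counit A) = obj A" "Cod S (counit A) = Unit S"
    "(\<one> (obj A) \<otimes> counit A) \<cdot> comult A = \<one> (obj A)"
  using assms by (auto simp: right_counital_def Hom_iff)

text \<open>With \<open>lleg\<close>, names the two arrows whose \<open>eqz\<close> is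
  \<open>pairs A s t\<close>, so that their behaviour under \<open>\<phi>\<close> and under
  \<open>f\<close> can be studied separately.\<close>

definition rleg :: "('o, 'a) comonoid \<Rightarrow> 'a \<Rightarrow> 'a" where
  "rleg A t = ((\<one> (obj A) \<otimes> t) \<cdot> comult A) \<otimes> \<one> (obj A)"

definition lleg :: "('o, 'a) comonoid \<Rightarrow> 'a \<Rightarrow> 'a" where
  "lleg A s = \<one> (obj A) \<otimes> (Inv S (Braid S (Cod S s) (obj A)) \<cdot> (\<one> (obj A) \<otimes> s) \<cdot> comult A)"

text \<open>Both coactions have the form \<open>(1 \<otimes> r) \<delta>\<close>, the left one
  followed by an inverse braiding, and \<open>e\<close> slides through that braiding because it is
  trivial at the unit. So both counit conditions reduce to the right counit law. The object
  \<open>x\<close> is general, to cover both \<open>C\<close> and \<open>C'\<close>.\<close>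

lemma pairs_equalizer:
  assumes A: "right_counital A" and s: "s \<in> Hom S (obj A) x" and t: "t \<in> Hom S (obj A) x"
    and e: "e \<in> Hom S x (Unit S)" and es: "e \<cdot> s = counit A" and et: "e \<cdot> t = counit A"
  shows "is_equalizer S (rleg A t) (lleg A s) (pairs A s t)"
proof -
  note [simp] = right_counital_simps[OF A] HomD[OF s] HomD[OF t] HomD[OF e]
  have "(e \<otimes> \<one> (obj A)) \<cdot> Inv S (Braid S x (obj A)) = \<one> (obj A) \<otimes> e"
    using Inv_Braid_natural[OF e, of "\<one> (obj A)"] by (simp add: Braid_Unit Hom_iff)
  then have "(e \<otimes> \<one> (obj A)) \<cdot> Inv S (Braid S x (obj A)) \<cdot> (\<one> (obj A) \<otimes> s) \<cdot> comult A = \<one> (obj A)"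
    by (subst Comp_assoc'[symmetric]) (auto simp: es)
  then show ?thesis unfolding rleg_def lleg_def pairs_def
    by (intro eqz_cotensor[of _ _ x _ _ e]) (auto simp: et)
qed

lemma rleg_simps:
  assumes "right_counital A" "t \<in> Hom S (obj A) x"
  shows "rleg A t \<in> Ar S" "Dom S (rleg A t) = obj A \<otimes>\<^sub>o obj A" "Cod S (rleg A t) = obj A \<otimes>\<^sub>o x \<otimes>\<^sub>o obj A"
  using assms HomD[OF assms(2)] by (auto simp: rleg_def right_counital_simps)

lemma lleg_simps:
  assumes "right_counital A" "s \<in> Hom S (obj A) x"
  shows "lleg A s \<in> Ar S" "Dom S (lleg A s) = obj A \<otimes>\<^sub>o obj A" "Cod S (lleg A s) = obj A \<otimes>\<^sub>o x \<otimes>\<^sub>o obj A"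
  using assms HomD[OF assms(2)] by (auto simp: lleg_def right_counital_simps)

text \<open>Together with \<open>lleg_natural\<close> this shows that
  \<open>\<phi> \<otimes> \<phi>\<close> carries what equalizes the legs of \<open>A\<close> over
  \<open>x\<close> to what equalizes the legs of \<open>A'\<close>; it yields the map induced by
  \<open>\<phi> \<otimes> \<phi>\<close> over \<open>C'\<close>.\<close>

lemma rleg_natural:
  assumes A: "right_counital A" "right_counital A'" and \<phi>: "comonoid_map A A' \<phi>" and t: "t \<in> Hom S (obj A') x"
  shows "rleg A' t \<cdot> (\<phi> \<otimes> \<phi>) = (\<phi> \<otimes> \<one> x \<otimes> \<phi>) \<cdot> rleg A (t \<cdot> \<phi>)"
proof -
  have \<phi>': "\<phi> \<in> Hom S (obj A) (obj A')" "comult A' \<cdot> \<phi> = (\<phi> \<otimes> \<phi>) \<cdot> comult A"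
    using \<phi> by (auto simp: comonoid_map_def)
  note [simp] = right_counital_simps[OF A(1)] right_counital_simps[OF A(2)] HomD[OF t] HomD[OF \<phi>'(1)]
  have "rleg A' t \<cdot> (\<phi> \<otimes> \<phi>) = ((\<phi> \<otimes> \<one> x) \<otimes> \<phi>) \<cdot> rleg A (t \<cdot> \<phi>)"
    by (simp add: rleg_def \<phi>'(2))
  then show ?thesis by (simp add: TensA_assoc)
qed

lemma lleg_natural:
  assumes A: "right_counital A" "right_counital A'" and \<phi>: "comonoid_map A A' \<phi>" and s: "s \<in> Hom S (obj A') x"
  shows "lleg A' s \<cdot> (\<phi> \<otimes> \<phi>) = (\<phi> \<otimes> \<one> x \<otimes> \<phi>) \<cdot> lleg A (s \<cdot> \<phi>)"
proof -
  have \<phi>': "\<phi> \<in> Hom S (obj A) (obj A')" "comult A' \<cdot> \<phi> = (\<phi> \<otimes> \<phi>) \<cdot> comult A"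
    using \<phi> by (auto simp: comonoid_map_def)
  note [simp] = right_counital_simps[OF A(1)] right_counital_simps[OF A(2)] HomD[OF s] HomD[OF \<phi>'(1)]
  have "Inv S (Braid S x (obj A')) \<cdot> (\<one> (obj A') \<otimes> s) \<cdot> comult A' \<cdot> \<phi> =
      (Inv S (Braid S x (obj A')) \<cdot> (\<phi> \<otimes> \<one> x)) \<cdot> (\<one> (obj A) \<otimes> (s \<cdot> \<phi>)) \<cdot> comult A"
    by (simp add: \<phi>'(2))
  also have "\<dots> = (\<one> x \<otimes> \<phi>) \<cdot> Inv S (Braid S x (obj A)) \<cdot> (\<one> (obj A) \<otimes> (s \<cdot> \<phi>)) \<cdot> comult A"
    by (subst Inv_Braid_natural[of _ x _ _ "obj A"]) (auto simp: Hom_iff)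
  finally show ?thesis by (simp add: lleg_def)
qed

text \<open>As \<open>f\<close> acts on the middle factor, and in the same way in
  \<open>lleg_base_change\<close>, what equalizes the legs over \<open>x\<close> also equalizes
  those over \<open>x'\<close>. This yields \<open>\<iota>\<close>.\<close>

lemma rleg_base_change:
  assumes A: "right_counital A" and t: "t \<in> Hom S (obj A) x" and f: "f \<in> Hom S x x'"
  shows "rleg A (f \<cdot> t) = (\<one> (obj A) \<otimes> f \<otimes> \<one> (obj A)) \<cdot> rleg A t"
proof -
  note [simp] = right_counital_simps[OF A] HomD[OF t] HomD[OF f]
  have "rleg A (f \<cdot> t) = ((\<one> (obj A) \<otimes> f) \<otimes> \<one> (obj A)) \<cdot> rleg A t"
    by (simp add: rleg_def)
  then show ?thesis by (simp add: TensA_assoc)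
qed

lemma lleg_base_change:
  assumes A: "right_counital A" and s: "s \<in> Hom S (obj A) x" and f: "f \<in> Hom S x x'"
  shows "lleg A (f \<cdot> s) = (\<one> (obj A) \<otimes> f \<otimes> \<one> (obj A)) \<cdot> lleg A s"
proof -
  note [simp] = right_counital_simps[OF A] HomD[OF s] HomD[OF f]
  have "Inv S (Braid S x' (obj A)) \<cdot> (\<one> (obj A) \<otimes> (f \<cdot> s)) \<cdot> comult A =
      (Inv S (Braid S x' (obj A)) \<cdot> (\<one> (obj A) \<otimes> f)) \<cdot> (\<one> (obj A) \<otimes> s) \<cdot> comult A"
    by simp
  also have "\<dots> = (f \<otimes> \<one> (obj A)) \<cdot> Inv S (Braid S x (obj A)) \<cdot> (\<one> (obj A) \<otimes> s) \<cdot> comult A"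
    by (subst Inv_Braid_natural[of _ x _ _ "obj A"]) (auto simp: Hom_iff)
  finally show ?thesis by (simp add: lleg_def)
qed

end

section \<open>Functors of quantum categories\<close>

context strict_base
begin

section \<open>The comonoid of arrows of a quantum graph\<close>

lemma enrich_simps [simp]:
  "obj (enrich K) = obj K \<otimes>\<^sub>o obj K" "counit (enrich K) = counit K \<otimes> counit K"
  by (auto simp: enrich_def op_def tens0_def)

lemma quantum_graph_simps:
  assumes "quantum_graph Q"
  shows "comonoid (base Q)" "cell1 (edge Q)" "src (edge Q) = enrich (base Q)" "tgt (edge Q) = enrich (base Q)"
    "ccounit Q \<in> Ar S" "Dom S (ccounit Q) = bimod (edge Q)"
    "Cod S (ccounit Q) = obj (base Q) \<otimes>\<^sub>o obj (base Q)"
    "cmult Q \<in> Ar S" "Dom S (cmult Q) = bimod (edge Q)"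
    "Cod S (cmult Q) = Dom S (incl (edge Q) (edge Q))"
    "cell2 (edge Q) (id1 (enrich (base Q))) (ccounit Q)"
    "run (edge Q) \<cdot> lwhisk (edge Q) (edge Q) (id1 (enrich (base Q))) (ccounit Q) \<cdot> cmult Q = \<one> (bimod (edge Q))"
  using assms unfolding quantum_graph_def comonad_def
  by (auto simp: cell2_def id1_def comp1_def Hom_iff)

text \<open>The right counit law of the comonad is an equation in the bicategory; removing the
  inclusions of the cotensor products from it leaves the counit law in the underlying
  category.\<close>

lemma right_counital_arrows:
  assumes Q: "quantum_graph Q"
  shows "right_counital (arrows Q)"
proof -
  define C A e where "C = base Q" and "A = edge Q" and "e = ccounit Q"
  note Q' [simp] = quantum_graph_simps[OF Q, folded C_def A_def e_def]
  note [simp] = cell1_simps(1)[OF Q'(2)] comonoid_simps[OF Q'(1)]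
    HomD[OF rcoact_Hom[OF Q'(2)]] HomD[OF lcoact_Hom[OF Q'(2)]]
  have K: "comonoid (enrich C)" using cell1_simps(7)[OF Q'(2)] by simp
  note [simp] = comonoid_simps(1-4)[OF K]
  have inclA: "is_equalizer S (rcoact A \<otimes> \<one> (bimod A)) (\<one> (bimod A) \<otimes> lcoact A) (incl A A)"
    by (rule incl_equalizer) auto
  note inclA' [simp] = equalizer_simps(1,2)[OF inclA]
  have inclK: "is_equalizer S (rcoact A \<otimes> \<one> (obj (enrich C))) (\<one> (bimod A) \<otimes> lcoact (id1 (enrich C)))
      (incl A (id1 (enrich C)))"
    using incl_id1_equalizer[OF Q'(2)] by simp
  note inclK' [simp] = equalizer_simps(1,2)[OF inclK]
  \<comment> \<open>The whiskering of \<open>e\<close> by \<open>A\<close> is the factorization of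
    \<open>?h\<close> through \<open>incl A (id1 (enrich C))\<close>. That \<open>?h\<close> factors
    is shown next: \<open>incl A A\<close> equalizes its pair and \<open>e\<close> respects left
    coactions.\<close>
  let ?h = "(\<one> (bimod A) \<otimes> e) \<cdot> incl A A"
  have "(rcoact A \<otimes> \<one> (obj (enrich C))) \<cdot> ?h = ((\<one> (bimod A) \<otimes> \<one> (obj (enrich C))) \<otimes> e) \<cdot> (rcoact A \<otimes> \<one> (bimod A)) \<cdot> incl A A"
    by simp
  also have "(rcoact A \<otimes> \<one> (bimod A)) \<cdot> incl A A = (\<one> (bimod A) \<otimes> lcoact A) \<cdot> incl A A"
    by (rule equalizer_simps(3)[OF inclA])
  also have "((\<one> (bimod A) \<otimes> \<one> (obj (enrich C))) \<otimes> e) \<cdot> \<dots> =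
      (\<one> (bimod A) \<otimes> ((\<one> (obj (enrich C)) \<otimes> e) \<cdot> lcoact A)) \<cdot> incl A A"
    by (subst TensA_assoc) auto
  also have "\<dots> = (\<one> (bimod A) \<otimes> (lcoact (id1 (enrich C)) \<cdot> e)) \<cdot> incl A A"
    using lcoact_id1_natural[OF Q'(2) Q'(11)] by simp
  also have "\<dots> = (\<one> (bimod A) \<otimes> lcoact (id1 (enrich C))) \<cdot> ?h"
    by (simp add: lcoact_id1[OF K])
  finally have h: "(rcoact A \<otimes> \<one> (obj (enrich C))) \<cdot> ?h = (\<one> (bimod A) \<otimes> lcoact (id1 (enrich C))) \<cdot> ?h" .
  have w: "lwhisk A A (id1 (enrich C)) e = lift (incl A (id1 (enrich C))) ?h"
    by (simp add: lwhisk_def hcomp_def)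
  have "?h \<in> Ar S" "Cod S ?h = Dom S (rcoact A \<otimes> \<one> (obj (enrich C)))" by simp_all
  note lift_h = lift_equalizer[OF inclK this h]
  note [simp] = lift_h(1-3)
  \<comment> \<open>The comonad law is rewritten until \<open>incl A A \<cdot> cmult Q\<close>, the
    comultiplication of \<open>arrows Q\<close>, and its counit appear.\<close>
  have "\<one> (bimod A) = run A \<cdot> lift (incl A (id1 (enrich C))) ?h \<cdot> cmult Q"
    using Q'(12) unfolding w by simp
  also have "\<dots> = (\<one> (bimod A) \<otimes> (counit C \<otimes> counit C)) \<cdot> (incl A (id1 (enrich C)) \<cdot> lift (incl A (id1 (enrich C))) ?h) \<cdot> cmult Q"
    by (simp add: run_def)
  also have "incl A (id1 (enrich C)) \<cdot> lift (incl A (id1 (enrich C))) ?h = ?h"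
    by (rule lift_h(4))
  also have "(\<one> (bimod A) \<otimes> (counit C \<otimes> counit C)) \<cdot> ?h \<cdot> cmult Q =
      (\<one> (bimod A) \<otimes> ((counit C \<otimes> counit C) \<cdot> e)) \<cdot> incl A A \<cdot> cmult Q"
    by simp
  finally show ?thesis
    unfolding right_counital_def arrows_def
    by (simp add: Hom_iff flip: C_def A_def e_def)
qed

lemma obj_arrows: "obj (arrows Q) = bimod (edge Q)"
  by (simp add: arrows_def)

text \<open>Supplies the \<open>e\<close> of \<open>pairs_equalizer\<close>, namely the counit of
  the base: composed with source or target it gives both counits applied to
  \<open>ccounit Q\<close>.\<close>

lemma source_target:
  assumes Q: "quantum_graph Q"
  shows "source Q \<in> Hom S (obj (arrows Q)) (obj (base Q))" "counit (base Q) \<cdot> source Q = counit (arrows Q)"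
    "target Q \<in> Hom S (obj (arrows Q)) (obj (base Q))" "counit (base Q) \<cdot> target Q = counit (arrows Q)"
proof -
  note Q' [simp] = quantum_graph_simps[OF Q]
  note [simp] = comonoid_simps[OF Q'(1)]
  let ?e = "counit (base Q)" and ?x = "obj (base Q)"
  have s: "?e \<cdot> (\<one> ?x \<otimes> ?e) = ?e \<otimes> ?e"
  proof -
    have "?e \<cdot> (\<one> ?x \<otimes> ?e) = (?e \<otimes> \<one> (Unit S)) \<cdot> (\<one> ?x \<otimes> ?e)" by simp
    also have "\<dots> = ?e \<otimes> ?e" by (simp del: TensA_Unit_right)
    finally show ?thesis .
  qed
  have t: "?e \<cdot> (?e \<otimes> \<one> ?x) = ?e \<otimes> ?e"
  proof -
    have "?e \<cdot> (?e \<otimes> \<one> ?x) = (\<one> (Unit S) \<otimes> ?e) \<cdot> (?e \<otimes> \<one> ?x)" by simp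
    also have "\<dots> = ?e \<otimes> ?e" by (simp del: TensA_Unit_left)
    finally show ?thesis .
  qed
  show "source Q \<in> Hom S (obj (arrows Q)) ?x" "target Q \<in> Hom S (obj (arrows Q)) ?x"
    by (auto simp: source_def target_def obj_arrows)
  have "?e \<cdot> source Q = (?e \<cdot> (\<one> ?x \<otimes> ?e)) \<cdot> ccounit Q" by (simp add: source_def)
  then show "?e \<cdot> source Q = counit (arrows Q)" unfolding s by (simp add: arrows_def)
  have "?e \<cdot> target Q = (?e \<cdot> (?e \<otimes> \<one> ?x)) \<cdot> ccounit Q" by (simp add: target_def)
  then show "?e \<cdot> target Q = counit (arrows Q)" unfolding t by (simp add: arrows_def)
qed

lemma quantum_category_graph: "quantum_category Q \<Longrightarrow> quantum_graph Q"
  by (simp add: quantum_category_def)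

lemma composable_equalizer:
  assumes Q: "quantum_graph Q"
  shows "is_equalizer S (rleg (arrows Q) (target Q)) (lleg (arrows Q) (source Q)) (composable Q)"
  unfolding composable_def
  using source_target[OF Q] comonoid_simps(5-7)[OF quantum_graph_simps(1)[OF Q]]
  by (intro pairs_equalizer[OF right_counital_arrows[OF Q], of _ "obj (base Q)" _ "counit (base Q)"]) auto

section \<open>Typing of the composition and unit maps\<close>

lemma nu2_Hom:
  assumes Q: "quantum_category Q"
  shows "nu2 Q \<in> Hom S (Dom S (composable Q)) (obj (arrows Q))"
proof -
  note Q' [simp] = quantum_graph_simps[OF quantum_category_graph[OF Q]]
  note [simp] = comonoid_simps[OF Q'(1)] cell1_simps(1)[OF Q'(2)]
  have "mu2 Q \<in> Hom S (Dom S (composable Q)) (obj (base Q) \<otimes>\<^sub>o bimod (edge Q))"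
    using Q by (simp add: quantum_category_def Let_def)
  note [simp] = HomD[OF this]
  show ?thesis by (auto simp: nu2_def obj_arrows)
qed

text \<open>The type of \<open>incl (coev C) A\<close> is known only once it is an equalizer, for
  which \<open>coev C\<close> must be a 1-cell. This is read off from the comonad map condition on
  \<open>(j, mu0)\<close>, and the type of \<open>mu0\<close> from the monoidal structure.\<close>

lemma nu0_Hom:
  assumes Q: "quantum_category Q"
  shows "nu0 Q \<in> Hom S (obj (base Q)) (obj (arrows Q))"
proof -
  note Q' [simp] = quantum_graph_simps[OF quantum_category_graph[OF Q]]
  note [simp] = comonoid_simps[OF Q'(1)] cell1_simps(1)[OF Q'(2)]
  let ?j = "coev (base Q)"
  obtain m2 where "monoidal_endo (pmonoidale (base Q)) (edge Q) m2 (mu0 Q)"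
    and k: "comonad_map (id1 unit0) (Inv S (lun (id1 unit0))) (\<one> (Unit S)) (edge Q) (cmult Q) (ccounit Q) ?j
      (mu0 Q \<cdot> lun ?j)"
    using Q by (auto simp: quantum_category_def Let_def)
  then have mu: "cell2 ?j (?j \<box> edge Q) (mu0 Q)"
    by (simp add: monoidal_endo_def pmonoidale_def Let_def)
  have j: "cell1 ?j" using k by (simp add: comonad_map_def)
  have tgt: "tgt ?j = src (edge Q)" by (simp add: coev_def)
  have "is_equalizer S (rcoact ?j \<otimes> \<one> (bimod (edge Q))) (\<one> (bimod ?j) \<otimes> lcoact (edge Q)) (incl ?j (edge Q))"
    by (rule incl_equalizer[OF j Q'(2) tgt])
  note [simp] = equalizer_simps(1,2)[OF this] HomD[OF rcoact_Hom[OF j]]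
  have [simp]: "bimod ?j = obj (base Q)" by (simp add: coev_def)
  have [simp]: "mu0 Q \<in> Ar S" "Dom S (mu0 Q) = obj (base Q)" "Cod S (mu0 Q) = Dom S (incl ?j (edge Q))"
    using cell2_simps[OF mu] by (auto simp: comp1_def)
  show ?thesis by (auto simp: nu0_def obj_arrows)
qed

text \<open>The part of \<open>quantum_functor\<close> that precedes composition and units; it is
  what makes \<open>pair_map\<close> well defined, so the remaining two equations can be stated with
  it.\<close>

definition graph_map :: "('o, 'a) qcat \<Rightarrow> ('o, 'a) qcat \<Rightarrow> 'a \<Rightarrow> 'a \<Rightarrow> bool" where
  "graph_map Q Q' f \<phi> \<longleftrightarrow> comonoid_map (base Q) (base Q') f \<and> comonoid_map (arrows Q) (arrows Q') \<phi> \<and>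
     source Q' \<cdot> \<phi> = f \<cdot> source Q \<and> target Q' \<cdot> \<phi> = f \<cdot> target Q"

section \<open>The induced map on composable pairs\<close>

lemma graph_mapD:
  assumes "graph_map Q Q' f \<phi>"
  shows "f \<in> Hom S (obj (base Q)) (obj (base Q'))" "\<phi> \<in> Hom S (obj (arrows Q)) (obj (arrows Q'))"
    "counit (arrows Q') \<cdot> \<phi> = counit (arrows Q)"
    "source Q' \<cdot> \<phi> = f \<cdot> source Q" "target Q' \<cdot> \<phi> = f \<cdot> target Q"
    "comonoid_map (arrows Q) (arrows Q') \<phi>"
  using assms by (auto simp: graph_map_def comonoid_map_def)

text \<open>The map \<open>(\<phi> \<otimes>\<^bsub>C'\<^esub> \<phi>) \<iota> : A \<otimes>\<^sub>C A \<rightarrow> A' \<otimes>\<^bsub>C'\<^esub> A'\<close>.\<close>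

definition pair_map :: "('o, 'a) qcat \<Rightarrow> ('o, 'a) qcat \<Rightarrow> 'a \<Rightarrow> 'a" where
  "pair_map Q Q' \<phi> = (let h = pairs (arrows Q) (source Q' \<cdot> \<phi>) (target Q' \<cdot> \<phi>)
     in lift (composable Q') ((\<phi> \<otimes> \<phi>) \<cdot> h) \<cdot> lift h (composable Q))"

lemma quantum_functor_iff:
  "quantum_functor Q Q' f \<phi> \<longleftrightarrow> graph_map Q Q' f \<phi> \<and> \<phi> \<cdot> nu0 Q = nu0 Q' \<cdot> f \<and>
     \<phi> \<cdot> nu2 Q = nu2 Q' \<cdot> pair_map Q Q' \<phi>"
  by (auto simp: quantum_functor_def graph_map_def pair_map_def Let_def)

lemma pair_map:
  assumes Q: "quantum_graph Q" and Q': "quantum_graph Q'" and F: "graph_map Q Q' f \<phi>"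
  shows "pair_map Q Q' \<phi> \<in> Hom S (Dom S (composable Q)) (Dom S (composable Q'))"
    "composable Q' \<cdot> pair_map Q Q' \<phi> = (\<phi> \<otimes> \<phi>) \<cdot> composable Q"
proof -
  let ?A = "arrows Q" and ?A' = "arrows Q'" and ?x = "obj (base Q)" and ?x' = "obj (base Q')"
  note A = right_counital_arrows[OF Q] and A' = right_counital_arrows[OF Q']
  note st = source_target[OF Q] and st' = source_target[OF Q'] and F' = graph_mapD[OF F]
  note [simp] = HomD[OF st(1)] HomD[OF st(3)] HomD[OF st'(1)] HomD[OF st'(3)] HomD[OF F'(1)] HomD[OF F'(2)]
    right_counital_simps[OF A] right_counital_simps[OF A']
    rleg_simps[OF A st(3)] lleg_simps[OF A st(1)] rleg_simps[OF A' st'(3)] lleg_simps[OF A' st'(1)]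
  note eQ = composable_equalizer[OF Q] and eQ' = composable_equalizer[OF Q']
  note [simp] = equalizer_simps(1,2)[OF eQ] equalizer_simps(1,2)[OF eQ']
    comonoid_simps(1-7)[OF quantum_graph_simps(1)[OF Q']]
  let ?s = "source Q' \<cdot> \<phi>" and ?t = "target Q' \<cdot> \<phi>"
  let ?h = "pairs ?A ?s ?t"
  have s: "?s \<in> Hom S (obj ?A) ?x'" and t: "?t \<in> Hom S (obj ?A) ?x'" by auto
  note [simp] = rleg_simps[OF A t] lleg_simps[OF A s]
  \<comment> \<open>A comonoid map preserves counits, so the counit of \<open>C'\<close> also serves
    as retraction for the intermediate object, where \<open>A\<close> is viewed over
    \<open>C'\<close>.\<close>
  have es: "counit (base Q') \<cdot> ?s = counit ?A"
  proof -
    have "counit (base Q') \<cdot> ?s = (counit (base Q') \<cdot> source Q') \<cdot> \<phi>" by simp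
    then show ?thesis unfolding st'(2) F'(3) .
  qed
  have et: "counit (base Q') \<cdot> ?t = counit ?A"
  proof -
    have "counit (base Q') \<cdot> ?t = (counit (base Q') \<cdot> target Q') \<cdot> \<phi>" by simp
    then show ?thesis unfolding st'(4) F'(3) .
  qed
  have h: "is_equalizer S (rleg ?A ?t) (lleg ?A ?s) ?h"
    by (rule pairs_equalizer[OF A s t _ es et]) auto
  note [simp] = equalizer_simps(1,2)[OF h]
  \<comment> \<open>Existence of \<open>\<iota>\<close>: the legs over \<open>C'\<close> are those
    over \<open>C\<close> followed by \<open>f\<close> in the middle.\<close>
  have "rleg ?A ?t \<cdot> composable Q = (\<one> (obj ?A) \<otimes> f \<otimes> \<one> (obj ?A)) \<cdot> rleg ?A (target Q) \<cdot> composable Q"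
    unfolding F'(5) rleg_base_change[OF A st(3) F'(1)] by simp
  also have "rleg ?A (target Q) \<cdot> composable Q = lleg ?A (source Q) \<cdot> composable Q"
    by (rule equalizer_simps(3)[OF eQ])
  also have "(\<one> (obj ?A) \<otimes> f \<otimes> \<one> (obj ?A)) \<cdot> \<dots> = lleg ?A ?s \<cdot> composable Q"
    unfolding F'(4) lleg_base_change[OF A st(1) F'(1)] by simp
  finally have 1: "rleg ?A ?t \<cdot> composable Q = lleg ?A ?s \<cdot> composable Q" .
  have "composable Q \<in> Ar S" "Cod S (composable Q) = Dom S (rleg ?A ?t)" by simp_all
  note i = lift_equalizer[OF h this 1]
  \<comment> \<open>Existence of the second factor: \<open>\<phi> \<otimes> \<phi>\<close> commutes
    with the legs, so its composite with \<open>?h\<close> equalizes those of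
    \<open>A'\<close>.\<close>
  have "rleg ?A' (target Q') \<cdot> (\<phi> \<otimes> \<phi>) \<cdot> ?h = (rleg ?A' (target Q') \<cdot> (\<phi> \<otimes> \<phi>)) \<cdot> ?h" by simp
  also have "\<dots> = (\<phi> \<otimes> \<one> ?x' \<otimes> \<phi>) \<cdot> rleg ?A ?t \<cdot> ?h"
    unfolding rleg_natural[OF A A' F'(6) st'(3)] by simp
  also have "rleg ?A ?t \<cdot> ?h = lleg ?A ?s \<cdot> ?h" by (rule equalizer_simps(3)[OF h])
  also have "(\<phi> \<otimes> \<one> ?x' \<otimes> \<phi>) \<cdot> \<dots> = (lleg ?A' (source Q') \<cdot> (\<phi> \<otimes> \<phi>)) \<cdot> ?h"
    unfolding lleg_natural[OF A A' F'(6) st'(1)] by simp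
  also have "\<dots> = lleg ?A' (source Q') \<cdot> (\<phi> \<otimes> \<phi>) \<cdot> ?h" by simp
  finally have 2: "rleg ?A' (target Q') \<cdot> (\<phi> \<otimes> \<phi>) \<cdot> ?h = lleg ?A' (source Q') \<cdot> (\<phi> \<otimes> \<phi>) \<cdot> ?h" .
  have "(\<phi> \<otimes> \<phi>) \<cdot> ?h \<in> Ar S" "Cod S ((\<phi> \<otimes> \<phi>) \<cdot> ?h) = Dom S (rleg ?A' (target Q'))" by simp_all
  note l = lift_equalizer[OF eQ' this 2]
  note [simp] = i(1-3) l(1-3)
  have p: "pair_map Q Q' \<phi> = lift (composable Q') ((\<phi> \<otimes> \<phi>) \<cdot> ?h) \<cdot> lift ?h (composable Q)"
    by (simp add: pair_map_def Let_def)
  then show "pair_map Q Q' \<phi> \<in> Hom S (Dom S (composable Q)) (Dom S (composable Q'))" by auto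
  have "composable Q' \<cdot> pair_map Q Q' \<phi> =
      (composable Q' \<cdot> lift (composable Q') ((\<phi> \<otimes> \<phi>) \<cdot> ?h)) \<cdot> lift ?h (composable Q)"
    unfolding p by simp
  also have "\<dots> = (\<phi> \<otimes> \<phi>) \<cdot> ?h \<cdot> lift ?h (composable Q)" unfolding l(4) by simp
  also have "\<dots> = (\<phi> \<otimes> \<phi>) \<cdot> composable Q" unfolding i(4) ..
  finally show "composable Q' \<cdot> pair_map Q Q' \<phi> = (\<phi> \<otimes> \<phi>) \<cdot> composable Q" .
qed

text \<open>For a composite functor the factors pass through different intermediate objects:
  \<open>A\<close> over \<open>C'\<close>, \<open>A'\<close> over \<open>C''\<close>,
  \<open>A\<close> over \<open>C''\<close>. Testing against the monomorphism
  \<open>composable Q'\<close> avoids comparing these.\<close>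

lemma pair_map_eqI:
  assumes Q: "quantum_graph Q" and Q': "quantum_graph Q'" and F: "graph_map Q Q' f \<phi>"
    and u: "u \<in> Hom S (Dom S (composable Q)) (Dom S (composable Q'))"
      "composable Q' \<cdot> u = (\<phi> \<otimes> \<phi>) \<cdot> composable Q"
  shows "pair_map Q Q' \<phi> = u"
  by (rule equalizer_mono[OF composable_equalizer[OF Q']])
    (use pair_map[OF Q Q' F] u in \<open>auto simp: Hom_iff\<close>)

section \<open>Identity and composite functors\<close>

lemma comonoid_map_Id: "right_counital K \<Longrightarrow> comonoid_map K K (\<one> (obj K))"
  by (auto simp: comonoid_map_def right_counital_simps)

text \<open>Stated for \<open>right_counital\<close> so as to serve both \<open>base Q\<close> and
  \<open>arrows Q\<close>.\<close>

lemma comonoid_map_Comp: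
  assumes K: "right_counital K" "right_counital L" "right_counital M"
    and f: "comonoid_map K L f" and g: "comonoid_map L M g"
  shows "comonoid_map K M (g \<cdot> f)"
proof -
  have f': "f \<in> Hom S (obj K) (obj L)" "comult L \<cdot> f = (f \<otimes> f) \<cdot> comult K" "counit L \<cdot> f = counit K"
    and g': "g \<in> Hom S (obj L) (obj M)" "comult M \<cdot> g = (g \<otimes> g) \<cdot> comult L" "counit M \<cdot> g = counit L"
    using f g by (auto simp: comonoid_map_def)
  note [simp] = right_counital_simps[OF K(1)] right_counital_simps[OF K(2)] right_counital_simps[OF K(3)]
    HomD[OF f'(1)] HomD[OF g'(1)]
  have "comult M \<cdot> g \<cdot> f = (comult M \<cdot> g) \<cdot> f" by simp
  also have "\<dots> = (g \<otimes> g) \<cdot> comult L \<cdot> f" unfolding g'(2) by simp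
  also have "\<dots> = ((g \<cdot> f) \<otimes> (g \<cdot> f)) \<cdot> comult K" unfolding f'(2) by simp
  finally have "comult M \<cdot> g \<cdot> f = ((g \<cdot> f) \<otimes> (g \<cdot> f)) \<cdot> comult K" .
  moreover have "counit M \<cdot> g \<cdot> f = (counit M \<cdot> g) \<cdot> f" by simp
  ultimately show ?thesis unfolding comonoid_map_def g'(3) f'(3) by auto
qed

lemma comonoid_right_counital: "comonoid K \<Longrightarrow> right_counital K"
  by (simp add: comonoid_def right_counital_def)

lemma quantum_functor_Id:
  assumes Q: "quantum_category Q"
  shows "quantum_functor Q Q (\<one> (obj (base Q))) (\<one> (obj (arrows Q)))"
proof -
  note G = quantum_category_graph[OF Q]
  note A = right_counital_arrows[OF G] and C = comonoid_right_counital[OF quantum_graph_simps(1)[OF G]]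
  note st = source_target[OF G]
  note [simp] = HomD[OF st(1)] HomD[OF st(3)] HomD[OF nu0_Hom[OF Q]] HomD[OF nu2_Hom[OF Q]]
    right_counital_simps[OF A] right_counital_simps[OF C]
    rleg_simps[OF A st(3)] equalizer_simps(1,2)[OF composable_equalizer[OF G]]
  have gm: "graph_map Q Q (\<one> (obj (base Q))) (\<one> (obj (arrows Q)))"
    using comonoid_map_Id[OF A] comonoid_map_Id[OF C] by (simp add: graph_map_def)
  have "pair_map Q Q (\<one> (obj (arrows Q))) = \<one> (Dom S (composable Q))"
    by (rule pair_map_eqI[OF G G gm]) auto
  with gm show ?thesis by (simp add: quantum_functor_iff)
qed

lemma quantum_functor_Comp:
  assumes Q: "quantum_category Q" "quantum_category Q'" "quantum_category Q''"
    and F: "quantum_functor Q Q' f \<phi>" and G: "quantum_functor Q' Q'' g \<psi>"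
  shows "quantum_functor Q Q'' (g \<cdot> f) (\<psi> \<cdot> \<phi>)"
proof -
  note q = quantum_category_graph[OF Q(1)] quantum_category_graph[OF Q(2)] quantum_category_graph[OF Q(3)]
  note A = right_counital_arrows[OF q(1)] right_counital_arrows[OF q(2)] right_counital_arrows[OF q(3)]
  note C = comonoid_right_counital[OF quantum_graph_simps(1)[OF q(1)]]
    comonoid_right_counital[OF quantum_graph_simps(1)[OF q(2)]]
    comonoid_right_counital[OF quantum_graph_simps(1)[OF q(3)]]
  have F': "graph_map Q Q' f \<phi>" "\<phi> \<cdot> nu0 Q = nu0 Q' \<cdot> f" "\<phi> \<cdot> nu2 Q = nu2 Q' \<cdot> pair_map Q Q' \<phi>"
    and G': "graph_map Q' Q'' g \<psi>" "\<psi> \<cdot> nu0 Q' = nu0 Q'' \<cdot> g" "\<psi> \<cdot> nu2 Q' = nu2 Q'' \<cdot> pair_map Q' Q'' \<psi>"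
    using F G by (auto simp: quantum_functor_iff)
  note st = source_target[OF q(1)] source_target[OF q(2)] source_target[OF q(3)]
  note c = composable_equalizer[OF q(1)] composable_equalizer[OF q(2)] composable_equalizer[OF q(3)]
  note f = graph_mapD[OF F'(1)] and g = graph_mapD[OF G'(1)]
  note pf = pair_map[OF q(1,2) F'(1)] and pg = pair_map[OF q(2,3) G'(1)]
  note [simp] = HomD[OF st(1)] HomD[OF st(3)] HomD[OF st(5)] HomD[OF st(7)] HomD[OF st(9)] HomD[OF st(11)]
    HomD[OF nu0_Hom[OF Q(1)]] HomD[OF nu2_Hom[OF Q(1)]] HomD[OF nu0_Hom[OF Q(2)]] HomD[OF nu2_Hom[OF Q(2)]]
    HomD[OF nu0_Hom[OF Q(3)]] HomD[OF nu2_Hom[OF Q(3)]]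
    HomD[OF f(1)] HomD[OF f(2)] HomD[OF g(1)] HomD[OF g(2)] HomD[OF pf(1)] HomD[OF pg(1)]
    equalizer_simps(1,2)[OF c(1)] equalizer_simps(1,2)[OF c(2)] equalizer_simps(1,2)[OF c(3)]
    rleg_simps[OF A(1) st(3)] rleg_simps[OF A(2) st(7)] rleg_simps[OF A(3) st(11)]
  have s: "source Q'' \<cdot> \<psi> \<cdot> \<phi> = g \<cdot> f \<cdot> source Q"
    by (simp add: Comp_square[OF g(4)] f(4))
  have t: "target Q'' \<cdot> \<psi> \<cdot> \<phi> = g \<cdot> f \<cdot> target Q"
    by (simp add: Comp_square[OF g(5)] f(5))
  have "comonoid_map (base Q) (base Q'') (g \<cdot> f)" "comonoid_map (arrows Q) (arrows Q'') (\<psi> \<cdot> \<phi>)"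
    using F'(1) G'(1) comonoid_map_Comp[OF C] comonoid_map_Comp[OF A] by (auto simp: graph_map_def)
  then have gm: "graph_map Q Q'' (g \<cdot> f) (\<psi> \<cdot> \<phi>)"
    using s t by (simp add: graph_map_def)
  \<comment> \<open>Pasting the two defining squares shows that the composite of the pair maps meets
    the test of \<open>pair_map_eqI\<close>.\<close>
  have "composable Q'' \<cdot> pair_map Q' Q'' \<psi> \<cdot> pair_map Q Q' \<phi> =
      (\<psi> \<otimes> \<psi>) \<cdot> composable Q' \<cdot> pair_map Q Q' \<phi>"
    by (rule Comp_square[OF pg(2)]) auto
  then have pm: "pair_map Q Q'' (\<psi> \<cdot> \<phi>) = pair_map Q' Q'' \<psi> \<cdot> pair_map Q Q' \<phi>"
    by (intro pair_map_eqI[OF q(1,3) gm]) (auto simp: pf(2))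
  have "(\<psi> \<cdot> \<phi>) \<cdot> nu0 Q = nu0 Q'' \<cdot> g \<cdot> f"
    by (simp add: F'(2) Comp_square[OF G'(2)])
  moreover have "(\<psi> \<cdot> \<phi>) \<cdot> nu2 Q = nu2 Q'' \<cdot> pair_map Q Q'' (\<psi> \<cdot> \<phi>)"
    by (simp add: F'(3) Comp_square[OF G'(3)] pm)
  ultimately show ?thesis using gm by (simp add: quantum_functor_iff)
qed

end

section \<open>The category of quantum categories\<close>

context quantum_base
begin

interpretation S: strict_base "strictify V"
  by (rule strict_base_strictify)

text \<open>The identity is rewritten with \<open>obj (S.arrows Q)\<close> in place of
  \<open>bimod (edge Q)\<close>, to match the typing of the components of a functor.\<close>

lemma qCat_simps:
  "Ob (qCat V) = qcats V"
  "u \<in> Ar (qCat V) \<longleftrightarrow> (\<exists>Q f \<phi> Q'. u = (Q, (f, \<phi>), Q') \<and> Q \<in> qcats V \<and> Q' \<in> qcats V \<and> S.quantum_functor Q Q' f \<phi>)"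
  "Dom (qCat V) (Q, F, Q') = Q"
  "Cod (qCat V) (Q, F, Q') = Q'"
  "Id (qCat V) Q = (Q, (\<one>\<^bsub>strictify V\<^esub> (obj (base Q)), \<one>\<^bsub>strictify V\<^esub> (obj (S.arrows Q))), Q)"
  "(Q', (f', \<phi>'), Q'') \<cdot>\<^bsub>qCat V\<^esub> (Q, (f, \<phi>), P) = (Q, (f' \<cdot>\<^bsub>strictify V\<^esub> f, \<phi>' \<cdot>\<^bsub>strictify V\<^esub> \<phi>), Q'')"
  by (auto simp: qCat_def Let_def S.obj_arrows)

text \<open>Composition is componentwise, so the unit and associativity laws are inherited from the
  strictification; the content is that identities and composites are functors.\<close>

lemma category_qCat: "category (qCat V)"
proof -
  have q: "Q \<in> qcats V \<Longrightarrow> S.quantum_category Q" for Q by (simp add: qcats_def)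
  have F: "S.quantum_functor Q Q' f \<phi> \<Longrightarrow> f \<in> Hom (strictify V) (obj (base Q)) (obj (base Q')) \<and>
      \<phi> \<in> Hom (strictify V) (obj (S.arrows Q)) (obj (S.arrows Q'))" for Q Q' f \<phi>
    by (simp add: S.quantum_functor_def S.comonoid_map_def)
  show ?thesis
  proof
    show "\<one>\<^bsub>qCat V\<^esub> Q \<in> Hom (qCat V) Q Q" if "Q \<in> Ob (qCat V)" for Q
    proof -
      have "\<one>\<^bsub>qCat V\<^esub> Q \<in> Ar (qCat V)"
        using that S.quantum_functor_Id[OF q] unfolding qCat_simps by blast
      then show ?thesis by (simp add: Hom_def qCat_simps(3-5) del: strictify_simps)
    qed
    show "v \<cdot>\<^bsub>qCat V\<^esub> u \<in> Hom (qCat V) Q Q''"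
      if uv: "u \<in> Hom (qCat V) Q Q'" "v \<in> Hom (qCat V) Q' Q''" for u v Q Q' Q''
    proof -
      obtain f \<phi> g \<psi> where u: "u = (Q, (f, \<phi>), Q')" "v = (Q', (g, \<psi>), Q'')"
        and Q: "Q \<in> qcats V" "Q' \<in> qcats V" "Q'' \<in> qcats V"
        and "S.quantum_functor Q Q' f \<phi>" "S.quantum_functor Q' Q'' g \<psi>"
        using uv by (auto simp: Hom_def qCat_simps simp del: strictify_simps)
      then have "S.quantum_functor Q Q'' (g \<cdot>\<^bsub>strictify V\<^esub> f) (\<psi> \<cdot>\<^bsub>strictify V\<^esub> \<phi>)"
        using q by (intro S.quantum_functor_Comp) auto
      with Q have "v \<cdot>\<^bsub>qCat V\<^esub> u \<in> Ar (qCat V)" unfolding u qCat_simps by blast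
      then show ?thesis by (simp add: u Hom_def qCat_simps(3-6) del: strictify_simps)
    qed
    show "u \<cdot>\<^bsub>qCat V\<^esub> \<one>\<^bsub>qCat V\<^esub> Q = u" if "u \<in> Hom (qCat V) Q Q'" for u Q Q'
      using that by (auto simp: Hom_def[of "qCat V"] qCat_simps simp del: strictify_simps
          dest!: F intro!: S.Comp_Id_right)
    show "\<one>\<^bsub>qCat V\<^esub> Q' \<cdot>\<^bsub>qCat V\<^esub> u = u" if "u \<in> Hom (qCat V) Q Q'" for u Q Q'
      using that by (auto simp: Hom_def[of "qCat V"] qCat_simps simp del: strictify_simps
          dest!: F intro!: S.Comp_Id_left)
    show "(w \<cdot>\<^bsub>qCat V\<^esub> v) \<cdot>\<^bsub>qCat V\<^esub> u = w \<cdot>\<^bsub>qCat V\<^esub> v \<cdot>\<^bsub>qCat V\<^esub> u"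
      if "u \<in> Hom (qCat V) P Q" "v \<in> Hom (qCat V) Q Q'" "w \<in> Hom (qCat V) Q' Q''" for u v w P Q Q' Q''
      using that by (auto simp: Hom_def[of "qCat V"] qCat_simps simp del: strictify_simps
          dest!: F intro!: S.Comp_assoc)
  qed (auto simp: qCat_simps)
qed

end

theorem theorem15:
  fixes V :: "('o, 'a, 'm) bmc_scheme"
  assumes "quantum_base V"
  shows "category (qCat V)"
  using assms by (rule quantum_base.category_qCat)

end
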